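(* Let $G$ be a subdivided $\Pi$-graph and let $u,v$ be two distinct branch vertices of $G$. Then there exist subgraphs $H_u,H_v\subseteq G$ such that $X:=V(H_u)\cap V(H_v)$ is non-empty and: (i) $H_u[X]=H_v[X]$, and this induced subgraph is finite and connected; (ii) $u,v\notin X$; (iii) $H_u/X$ is a subdivided $\Pi$-graph in which $u$ and $X$ are branch vertices, and $H_v/X$ is a subdivided $\Pi$-graph in which $v$ and $X$ are branch vertices; (iv) $uX$ is an edge of $H_u/X$ and $vX$ is an edge of $H_v/X$.
   Context: Graphs are simple and may be infinite. A graph is infinitely edge-connected if it has at least two vertices and $G-E'$ is connected for every finite edge set $E'$. A $\Pi$-graph is an infinitely edge-connected graph that does not contain infinitely many internally vertex-disjoint paths between any two of its vertices. A subdivided $\Pi$-graph is a graph $G$ that is a subdivision of a $\Pi$-graph $\Gamma$ (each edge of $\Gamma$ replaced by a path whose inner vertices are new); the vertices of $G$ corresponding to vertices of $\Gamma$ are its branch vertices. For a graph $H$ and a set $X\subseteq V(H)$ with $H[X]$ connected, $H/X$ denotes the graph obtained from $H$ by contracting $X$ to a single new vertex, itself denoted $X$: its vertex set is $(V(H)\setminus X)\cup\{X\}$, it contains all edges of $H-X$, and $X$ is adjacent to exactly those vertices outside $X$ that have a neighbour in $X$. *)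

theory Defs
  imports Main
begin

text \<open>Simple (possibly infinite) graphs: a vertex set and a set of 2-element edges.\<close>
record 'a graph =
  verts :: "'a set"
  edges :: "'a set set"

definition wf_graph :: "'a graph \<Rightarrow> bool" where
  "wf_graph G \<longleftrightarrow> (\<forall>e\<in>edges G. card e = 2 \<and> e \<subseteq> verts G)"

definition subgraph :: "'a graph \<Rightarrow> 'a graph \<Rightarrow> bool" where
  "subgraph H G \<longleftrightarrow> wf_graph H \<and> verts H \<subseteq> verts G \<and> edges H \<subseteq> edges G"

definition induced :: "'a graph \<Rightarrow> 'a set \<Rightarrow> 'a graph" where
  "induced H X = \<lparr>verts = X, edges = {e \<in> edges H. e \<subseteq> X}\<rparr>"

definition adj :: "'a graph \<Rightarrow> ('a \<times> 'a) set" where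
  "adj G = {(a, b). {a, b} \<in> edges G}"

definition connected_graph :: "'a graph \<Rightarrow> bool" where
  "connected_graph G \<longleftrightarrow> (\<forall>x\<in>verts G. \<forall>y\<in>verts G. (x, y) \<in> (adj G)\<^sup>*)"

text \<open>Paths as lists of distinct vertices, consecutive ones adjacent.\<close>
definition gpath :: "'a graph \<Rightarrow> 'a list \<Rightarrow> bool" where
  "gpath G p \<longleftrightarrow> p \<noteq> [] \<and> distinct p \<and> set p \<subseteq> verts G \<and>
     (\<forall>i. Suc i < length p \<longrightarrow> {p ! i, p ! Suc i} \<in> edges G)"

definition inner :: "'a list \<Rightarrow> 'a set" where
  "inner p = set (butlast (tl p))"

definition path_edges :: "'a list \<Rightarrow> 'a set set" where
  "path_edges p = {{p ! i, p ! Suc i} | i. Suc i < length p}"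

definition inf_edge_connected :: "'a graph \<Rightarrow> bool" where
  "inf_edge_connected G \<longleftrightarrow> (\<exists>x\<in>verts G. \<exists>y\<in>verts G. x \<noteq> y) \<and>
     (\<forall>F. finite F \<longrightarrow> connected_graph \<lparr>verts = verts G, edges = edges G - F\<rparr>)"

definition pi_graph :: "'a graph \<Rightarrow> bool" where
  "pi_graph G \<longleftrightarrow> wf_graph G \<and> inf_edge_connected G \<and>
     (\<forall>x\<in>verts G. \<forall>y\<in>verts G. x \<noteq> y \<longrightarrow>
        \<not> (\<exists>Ps. infinite Ps \<and> (\<forall>p\<in>Ps. gpath G p \<and> hd p = x \<and> last p = y) \<and>
               (\<forall>p\<in>Ps. \<forall>q\<in>Ps. p \<noteq> q \<longrightarrow> inner p \<inter> inner q = {})))"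

text \<open>G is a subdivision of Gamma, where the vertices of Gamma are themselves
  the branch vertices of G (no loss of generality, up to relabelling).\<close>
definition subdivision_of :: "'a graph \<Rightarrow> 'a graph \<Rightarrow> bool" where
  "subdivision_of G \<Gamma> \<longleftrightarrow> wf_graph G \<and> wf_graph \<Gamma> \<and> verts \<Gamma> \<subseteq> verts G \<and>
     (\<exists>P. (\<forall>e\<in>edges \<Gamma>. gpath G (P e) \<and> {hd (P e), last (P e)} = e \<and>
                         inner (P e) \<inter> verts \<Gamma> = {}) \<and>
          (\<forall>e\<in>edges \<Gamma>. \<forall>e'\<in>edges \<Gamma>. e \<noteq> e' \<longrightarrow> inner (P e) \<inter> inner (P e') = {}) \<and>
          verts G = verts \<Gamma> \<union> (\<Union>e\<in>edges \<Gamma>. inner (P e)) \<and>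
          edges G = (\<Union>e\<in>edges \<Gamma>. path_edges (P e)))"

text \<open>G is a subdivided Pi-graph with branch vertex set B.\<close>
definition subdivided_pi :: "'a graph \<Rightarrow> 'a set \<Rightarrow> bool" where
  "subdivided_pi G B \<longleftrightarrow> (\<exists>\<Gamma>. verts \<Gamma> = B \<and> pi_graph \<Gamma> \<and> subdivision_of G \<Gamma>)"

text \<open>Contraction H/X: a vertex w outside X is represented by {w}, the new vertex by X.\<close>
definition contract :: "'a graph \<Rightarrow> 'a set \<Rightarrow> 'a set graph" where
  "contract H X = \<lparr>verts = (\<lambda>w. {w}) ` (verts H - X) \<union> {X},
     edges = {{{a}, {b}} | a b. {a, b} \<in> edges H \<and> a \<notin> X \<and> b \<notin> X}
           \<union> {{X, {w}} | w. w \<in> verts H - X \<and> (\<exists>x\<in>X. {x, w} \<in> edges H)}\<rparr>"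

end

theory Submission
  imports Defs
begin

text \<open>In a subdivided \<open>\<Pi>\<close>-graph any two vertices are separated by finitely many vertices and edges.
  Take such a separator \<open>S\<close> of \<open>u\<close> and \<open>v\<close>, with sides \<open>C u\<close> and \<open>C v\<close>. Since \<open>u\<close> and \<open>v\<close> are not
  separated by finitely many edges, there is a \<open>u\<close>--\<open>v\<close> path whose first and last vertices \<open>s\<close>,
  \<open>s'\<close> in \<open>S\<close> are not separated by finitely many edges from \<open>u\<close> inside \<open>C u\<close>, respectively from
  \<open>v\<close> inside \<open>C v\<close>; its set of inner vertices serves as \<open>X\<close>.

  It remains to find, in a graph with finite separators, a subdivided \<open>\<Pi>\<close>-graph around an edge \<open>xy\<close>
  whose ends are not separated by finitely many edges. Let \<open>U\<close> be the set of vertices that no finite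
  edge set separates from \<open>x\<close>. A vertex outside \<open>U\<close> can be cut off from \<open>U\<close> by finitely many edges,
  and so can all direct connections (paths without inner vertices in \<open>U\<close>) between two given vertices
  of \<open>U\<close>. Hence finitely many direct connections never block the construction of further ones that
  have new inner vertices and new pairs of ends, and countably many steps suffice.\<close>

section \<open>Reachability and paths\<close>

text \<open>\<open>E\<close> is the set of surviving edges and \<open>S\<close> the set of deleted
  vertices. Being a reflexive closure, the relation relates even a deleted vertex to itself, so
  separation statements demand separately that the ends lie outside \<open>S\<close>.\<close>

definition reach :: "'a set set \<Rightarrow> 'a set \<Rightarrow> ('a \<times> 'a) set" where
  "reach E S = {(a, b). {a, b} \<in> E \<and> a \<notin> S \<and> b \<notin> S}\<^sup>*"

lemma reach_refl [simp]: "(a, a) \<in> reach E S"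
  by (simp add: reach_def)

lemma reach_edge: "{a, b} \<in> E \<Longrightarrow> a \<notin> S \<Longrightarrow> b \<notin> S \<Longrightarrow> (a, b) \<in> reach E S"
  unfolding reach_def by (rule r_into_rtrancl) simp

lemma reach_trans: "(a, b) \<in> reach E S \<Longrightarrow> (b, c) \<in> reach E S \<Longrightarrow> (a, c) \<in> reach E S"
  unfolding reach_def by (rule rtrancl_trans)

lemma reach_sym:
  assumes "(a, b) \<in> reach E S"
  shows "(b, a) \<in> reach E S"
proof -
  have "sym {(a, b). {a, b} \<in> E \<and> a \<notin> S \<and> b \<notin> S}"
    by (auto simp: sym_def insert_commute)
  then show ?thesis
    using assms unfolding reach_def by (meson sym_rtrancl symD)
qed

lemma reach_mono:
  assumes "(a, b) \<in> reach E S" "E \<subseteq> E'" "S' \<subseteq> S"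
  shows "(a, b) \<in> reach E' S'"
proof -
  have "reach E S \<subseteq> reach E' S'"
    unfolding reach_def by (rule rtrancl_mono) (use assms(2,3) in auto)
  then show ?thesis using assms(1) by blast
qed

text \<open>The tool for all non-reachability proofs below: a set \<open>R\<close> is exhibited that
  contains \<open>a\<close> but not \<open>b\<close> and that no surviving edge leaves.\<close>

lemma reach_closed:
  assumes "(a, b) \<in> reach E S" "a \<in> R"
    and step: "\<And>c d. c \<in> R \<Longrightarrow> {c, d} \<in> E \<Longrightarrow> c \<notin> S \<Longrightarrow> d \<notin> S \<Longrightarrow> d \<in> R"
  shows "b \<in> R"
  using assms(1) unfolding reach_def
  by (induction rule: rtrancl_induct) (use assms(2) step in auto)

lemma reach_avoids: "(a, b) \<in> reach E S \<Longrightarrow> a \<notin> S \<Longrightarrow> b \<notin> S"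
  using reach_closed[of a b E S "- S"] by simp

lemma adj_rtrancl_eq_reach: "(adj G)\<^sup>* = reach (edges G) {}"
  by (simp add: adj_def reach_def)

section \<open>Edge sets of paths given as vertex lists\<close>

lemma path_edges_simps [simp]:
  "path_edges [] = {}" "path_edges [a] = {}"
  "path_edges (a # b # p) = insert {a, b} (path_edges (b # p))"
proof -
  show "path_edges (a # b # p) = insert {a, b} (path_edges (b # p))"
  proof (intro equalityI subsetI)
    fix e assume "e \<in> path_edges (a # b # p)"
    then obtain i where "Suc i < length (a # b # p)"
      "e = {(a # b # p) ! i, (a # b # p) ! Suc i}"
      by (auto simp: path_edges_def)
    then show "e \<in> insert {a, b} (path_edges (b # p))"
      by (cases i) (auto simp: path_edges_def)
  next
    fix e assume "e \<in> insert {a, b} (path_edges (b # p))"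
    then consider "e = {a, b}"
      | i where "Suc i < length (b # p)" "e = {(b # p) ! i, (b # p) ! Suc i}"
      by (auto simp: path_edges_def)
    then show "e \<in> path_edges (a # b # p)"
    proof cases
      case 1
      then show ?thesis by (force simp: path_edges_def intro: exI[of _ 0])
    next
      case (2 i)
      then show ?thesis
        unfolding path_edges_def by (intro CollectI exI[of _ "Suc i"]) auto
    qed
  qed
qed (auto simp: path_edges_def)

lemma gpath_iff:
  "gpath G p \<longleftrightarrow> p \<noteq> [] \<and> distinct p \<and> set p \<subseteq> verts G \<and> path_edges p \<subseteq> edges G"
  unfolding gpath_def path_edges_def by blast

lemma path_edges_append:
  "path_edges (p @ c # q) = path_edges (p @ [c]) \<union> path_edges (c # q)"
proof (induction p)
  case (Cons a p)
  then show ?case by (cases p) auto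
qed simp

lemma path_edges_rev: "path_edges (rev p) = path_edges p"
proof (induction p)
  case (Cons a p)
  then show ?case
    by (cases p) (auto simp: path_edges_append[of _ _ "[a]"] insert_commute)
qed simp

lemma path_edges_subset: "e \<in> path_edges p \<Longrightarrow> e \<subseteq> set p"
  by (auto simp: path_edges_def)

lemma finite_path_edges: "finite (path_edges p)"
  by (rule finite_subset[of _ "Pow (set p)"]) (use path_edges_subset in auto)

lemma card_path_edge: "distinct p \<Longrightarrow> e \<in> path_edges p \<Longrightarrow> card e = 2"
  by (auto simp: path_edges_def nth_eq_iff_index_eq)

lemma path_reach:
  assumes "path_edges p \<subseteq> E" "set p \<inter> S = {}" "c \<in> set p"
  shows "(hd p, c) \<in> reach E S"
  using assms
proof (induction p)
  case (Cons a p)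
  show ?case
  proof (cases p)
    case Nil
    then show ?thesis using Cons.prems by simp
  next
    case (Cons b q)
    then show ?thesis
      using Cons.IH Cons.prems reach_edge[of a b E S] by (auto intro: reach_trans)
  qed
qed simp

text \<open>Induction from the first step of the walk. If the new first vertex already lies on the
  path found so far, the path is shortened to its suffix from that vertex, which keeps it
  distinct.\<close>

lemma reach_path:
  assumes "(a, b) \<in> reach E S" "a \<notin> S"
  obtains p where "p \<noteq> []" "hd p = a" "last p = b" "distinct p"
    "path_edges p \<subseteq> E" "set p \<inter> S = {}"
proof -
  have "a \<notin> S \<longrightarrow> (\<exists>p. p \<noteq> [] \<and> hd p = a \<and> last p = b \<and> distinct p \<and>
      path_edges p \<subseteq> E \<and> set p \<inter> S = {})"
    using assms(1) unfolding reach_def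
  proof (induction rule: converse_rtrancl_induct)
    case base
    show ?case by (auto intro!: exI[of _ "[b]"])
  next
    case (step a c)
    show ?case
    proof
      assume "a \<notin> S"
      from step obtain p where p: "p \<noteq> []" "hd p = c" "last p = b" "distinct p"
        "path_edges p \<subseteq> E" "set p \<inter> S = {}" by auto
      then obtain q where q: "p = c # q" by (metis list.exhaust_sel)
      show "\<exists>p. p \<noteq> [] \<and> hd p = a \<and> last p = b \<and> distinct p \<and>
          path_edges p \<subseteq> E \<and> set p \<inter> S = {}"
      proof (cases "a \<in> set p")
        case True
        then obtain r s where "p = r @ a # s" by (meson split_list)
        then show ?thesis
          using p path_edges_append[of r a s] by (intro exI[of _ "a # s"]) auto
      next
        case False
        then show ?thesis
          using p q step(1) \<open>a \<notin> S\<close> by (intro exI[of _ "a # p"]) auto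
      qed
    qed
  qed
  then show thesis using assms(2) that by blast
qed

lemma list_ends_cases:
  assumes "p \<noteq> []" "hd p = a" "last p = b" "a \<noteq> b"
  obtains m where "p = a # m @ [b]"
proof -
  obtain q where p: "p = a # q" using assms(1,2) by (cases p) auto
  then have "q \<noteq> []" using assms(3,4) by auto
  then show ?thesis using p assms(3) that[of "butlast q"] append_butlast_last_id[of q] by simp
qed

lemma inner_simp [simp]: "inner (a # m @ [b]) = set m"
  by (simp add: inner_def)

lemma set_eq_ends_inner:
  assumes "p \<noteq> []" "hd p = a" "last p = b" "a \<noteq> b"
  shows "set p = {a, b} \<union> inner p"
proof -
  obtain m where "p = a # m @ [b]" using assms by (rule list_ends_cases)
  then show ?thesis by auto
qed

text \<open>An inner vertex would force the edge \<open>{a, b}\<close> either to be the first edge,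
  so that \<open>b\<close> is repeated, or to lie behind it, so that \<open>a\<close> is
  repeated.\<close>

lemma path_edges_ends:
  assumes "p \<noteq> []" "hd p = a" "last p = b" "a \<noteq> b" "distinct p" "{a, b} \<in> path_edges p"
  shows "p = [a, b]"
proof -
  obtain m where m: "p = a # m @ [b]" using assms(1-4) by (rule list_ends_cases)
  show ?thesis
  proof (cases m)
    case Nil
    then show ?thesis using m by simp
  next
    case (Cons c m')
    then have "{a, b} = {a, c} \<or> {a, b} \<in> path_edges (c # m' @ [b])"
      using m assms(6) by simp
    then show ?thesis
      using path_edges_subset[of "{a, b}" "c # m' @ [b]"] assms(5) m Cons
      by (auto simp: doubleton_eq_iff)
  qed
qed

section \<open>Finite separators\<close>

text \<open>Deleting finitely many edges along with finitely many vertices makes the notion closed under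
  subgraphs, contractions of finite sets and subdivisions.\<close>

definition finitely_separable :: "'a graph \<Rightarrow> bool" where
  "finitely_separable G \<longleftrightarrow> (\<forall>x\<in>verts G. \<forall>y\<in>verts G. x \<noteq> y \<longrightarrow>
     (\<exists>F S. finite F \<and> finite S \<and> x \<notin> S \<and> y \<notin> S \<and> (x, y) \<notin> reach (edges G - F) S))"

lemma finitely_separableE:
  assumes "finitely_separable G" "x \<in> verts G" "y \<in> verts G" "x \<noteq> y"
  obtains F S where "finite F" "finite S" "x \<notin> S" "y \<notin> S" "(x, y) \<notin> reach (edges G - F) S"
  using assms unfolding finitely_separable_def by meson

lemma finitely_separable_subgraph:
  assumes "finitely_separable G" "subgraph H G"
  shows "finitely_separable H"
  unfolding finitely_separable_def
proof (intro ballI impI)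
  fix x y assume "x \<in> verts H" "y \<in> verts H" "x \<noteq> y"
  then obtain F S where "finite F" "finite S" "x \<notin> S" "y \<notin> S" "(x, y) \<notin> reach (edges G - F) S"
    using assms finitely_separableE[of G x y] by (auto simp: subgraph_def)
  moreover have "edges H - F \<subseteq> edges G - F" using assms(2) by (auto simp: subgraph_def)
  ultimately show "\<exists>F S. finite F \<and> finite S \<and> x \<notin> S \<and> y \<notin> S \<and> (x, y) \<notin> reach (edges H - F) S"
    by (meson reach_mono order_refl)
qed

text \<open>Zorn's lemma gives a maximal family of internally disjoint paths from \<open>x\<close>
  to \<open>y\<close>, which is finite in a \<Pi>-graph. Its inner vertices form the separator,
  together with the edge \<open>{x, y}\<close>, since the path \<open>[x, y]\<close> has no inner
  vertex by which it could be hit.\<close>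

lemma pi_graph_finitely_separable:
  assumes "pi_graph G"
  shows "finitely_separable G"
  unfolding finitely_separable_def
proof (intro ballI impI)
  fix x y assume xy: "x \<in> verts G" "y \<in> verts G" "x \<noteq> y"
  define good where "good Ps \<longleftrightarrow> (\<forall>p\<in>Ps. gpath G p \<and> hd p = x \<and> last p = y) \<and>
    (\<forall>p\<in>Ps. \<forall>q\<in>Ps. p \<noteq> q \<longrightarrow> inner p \<inter> inner q = {})" for Ps
  have fin: "finite Ps" if "good Ps" for Ps
    using assms xy that unfolding pi_graph_def good_def by blast
  have "\<exists>M\<in>{Ps. good Ps}. \<forall>Ps\<in>{Ps. good Ps}. M \<subseteq> Ps \<longrightarrow> Ps = M"
  proof (rule subset_Zorn)
    fix C assume C: "subset.chain {Ps. good Ps} C"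
    have "good (\<Union>C)"
      unfolding good_def
    proof (intro conjI ballI impI)
      fix p q assume pq: "p \<in> \<Union>C" "q \<in> \<Union>C" "p \<noteq> q"
      then obtain A B where AB: "A \<in> C" "p \<in> A" "B \<in> C" "q \<in> B" by blast
      then have "A \<subseteq> B \<or> B \<subseteq> A" using C by (auto simp: subset_chain_def)
      then obtain D where "D \<in> C" "p \<in> D" "q \<in> D" using AB by blast
      moreover from this have "good D" using C by (auto simp: subset_chain_def)
      ultimately show "inner p \<inter> inner q = {}"
        using pq(3) unfolding good_def by blast
    qed (use C in \<open>auto simp: subset_chain_def good_def\<close>)
    then show "\<exists>U\<in>{Ps. good Ps}. \<forall>X\<in>C. X \<subseteq> U" by blast
  qed
  then obtain M where M: "good M" and max: "\<And>Ps. good Ps \<Longrightarrow> M \<subseteq> Ps \<Longrightarrow> Ps = M" by blast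
  let ?S = "\<Union>p\<in>M. inner p"
  have path_ends: "x \<notin> inner p \<and> y \<notin> inner p"
    if gp: "gpath G p" "hd p = x" "last p = y" for p
  proof -
    obtain m where "p = x # m @ [y]"
      using list_ends_cases[of p x y] gp xy(3) by (auto simp: gpath_def)
    then show ?thesis using gp by (auto simp: gpath_def)
  qed
  have "(x, y) \<notin> reach (edges G - {{x, y}}) ?S"
  proof
    assume "(x, y) \<in> reach (edges G - {{x, y}}) ?S"
    moreover have "x \<notin> ?S" using M path_ends by (auto simp: good_def)
    ultimately obtain p where p: "p \<noteq> []" "hd p = x" "last p = y" "distinct p"
      "path_edges p \<subseteq> edges G - {{x, y}}" "set p \<inter> ?S = {}" by (rule reach_path)
    obtain m where m: "p = x # m @ [y]" using list_ends_cases[of p x y] p(1-3) xy(3) by auto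
    have "m \<noteq> []" using p(5) m by auto
    have "set p \<subseteq> verts G"
    proof
      fix c assume "c \<in> set p"
      then have "(x, c) \<in> reach (edges G) {}" using path_reach[of p "edges G" "{}" c] p by auto
      then show "c \<in> verts G"
        by (rule reach_closed) (use xy assms in \<open>auto simp: pi_graph_def wf_graph_def\<close>)
    qed
    then have gp: "gpath G p" using p by (auto simp: gpath_iff)
    have "inner p \<subseteq> set p" using m by auto
    then have disj: "inner p \<inter> inner q = {}" if "q \<in> M" for q using p(6) that by blast
    have "good (insert p M)"
      using M gp p(2,3) disj unfolding good_def by (auto simp: Int_commute)
    \<comment> \<open>By maximality \<open>p\<close> is itself a member of \<open>M\<close>, so its
      nonempty set of inner vertices would be disjoint from itself.\<close>
    then have "p \<in> M" using max by blast
    then show False using disj[of p] m \<open>m \<noteq> []\<close> by simp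
  qed
  moreover have "finite ?S" using fin[OF M] by (simp add: inner_def)
  moreover have "x \<notin> ?S" "y \<notin> ?S" using M path_ends by (auto simp: good_def)
  ultimately show "\<exists>F S. finite F \<and> finite S \<and> x \<notin> S \<and> y \<notin> S \<and> (x, y) \<notin> reach (edges G - F) S"
    by (metis finite.emptyI finite.insertI)
qed

text \<open>Every path from \<open>x\<close> to \<open>y\<close> uses an edge of \<open>F\<close> or
  has an inner vertex in \<open>S\<close>. Internally disjoint paths cannot share such an element,
  so a family of them injects into the finite disjoint sum of \<open>F\<close> and
  \<open>S\<close>.\<close>

lemma pi_graphI:
  assumes wf: "wf_graph G" and con: "inf_edge_connected G" and sep: "finitely_separable G"
  shows "pi_graph G"
  unfolding pi_graph_def
proof (intro conjI ballI impI notI)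
  fix x y assume xy: "x \<in> verts G" "y \<in> verts G" "x \<noteq> y"
  assume "\<exists>Ps. infinite Ps \<and> (\<forall>p\<in>Ps. gpath G p \<and> hd p = x \<and> last p = y) \<and>
    (\<forall>p\<in>Ps. \<forall>q\<in>Ps. p \<noteq> q \<longrightarrow> inner p \<inter> inner q = {})"
  then obtain Ps where "infinite Ps \<and> (\<forall>p\<in>Ps. gpath G p \<and> hd p = x \<and> last p = y) \<and>
    (\<forall>p\<in>Ps. \<forall>q\<in>Ps. p \<noteq> q \<longrightarrow> inner p \<inter> inner q = {})" by (elim exE)
  then have Ps: "infinite Ps" "\<And>p. p \<in> Ps \<Longrightarrow> gpath G p \<and> hd p = x \<and> last p = y"
    "\<And>p q. p \<in> Ps \<Longrightarrow> q \<in> Ps \<Longrightarrow> p \<noteq> q \<Longrightarrow> inner p \<inter> inner q = {}"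
    by (simp_all only: Ball_def) blast+
  obtain F S where FS: "finite F" "finite S" "x \<notin> S" "y \<notin> S"
    "(x, y) \<notin> reach (edges G - F) S"
    using finitely_separableE[OF sep xy] .
  have set_p: "set p = {x, y} \<union> inner p" if "p \<in> Ps" for p
    using set_eq_ends_inner[of p x y] Ps(2)[OF that] xy(3) by (simp add: gpath_def)
  \<comment> \<open>A shared edge can only join \<open>x\<close> and \<open>y\<close>, and then both
    paths are \<open>[x, y]\<close>.\<close>
  have edge_disj: "path_edges p \<inter> path_edges q = {}" if "p \<in> Ps" "q \<in> Ps" "p \<noteq> q" for p q
  proof (rule ccontr)
    assume "path_edges p \<inter> path_edges q \<noteq> {}"
    then obtain e where e: "e \<in> path_edges p" "e \<in> path_edges q" by blast
    have "e \<subseteq> {x, y}"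
      using path_edges_subset[OF e(1)] path_edges_subset[OF e(2)] set_p[OF that(1)]
        set_p[OF that(2)] Ps(3)[OF that] by blast
    moreover have "card e = 2" using card_path_edge[OF _ e(1)] Ps(2)[OF that(1)]
      by (auto simp: gpath_def)
    ultimately have "e = {x, y}"
      using card_seteq[of "{x, y}" e] xy(3) by simp
    then have "p = [x, y]" "q = [x, y]"
      using path_edges_ends[of p x y] path_edges_ends[of q x y] e Ps(2)[OF that(1)] Ps(2)[OF that(2)] xy(3)
      by (auto simp: gpath_def)
    then show False using that(3) by simp
  qed
  have "\<exists>w \<in> Inl ` F \<union> Inr ` S. case w of Inl e \<Rightarrow> e \<in> path_edges p | Inr s \<Rightarrow> s \<in> inner p"
    if "p \<in> Ps" for p
  proof (rule ccontr)
    assume neg: "\<not> ?thesis"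
    have "path_edges p \<inter> F = {}" using neg by force
    moreover have "inner p \<inter> S = {}" using neg by force
    ultimately
    have "path_edges p \<subseteq> edges G - F" "set p \<inter> S = {}"
      using Ps(2)[OF that] set_p[OF that] FS by (auto simp: gpath_iff)
    then have "(x, y) \<in> reach (edges G - F) S"
      using path_reach[of p _ S y] Ps(2)[OF that] set_p[OF that] by auto
    then show False using FS by blast
  qed
  then obtain w where w: "\<And>p. p \<in> Ps \<Longrightarrow> w p \<in> Inl ` F \<union> Inr ` S"
    "\<And>p. p \<in> Ps \<Longrightarrow> (case w p of Inl e \<Rightarrow> e \<in> path_edges p | Inr s \<Rightarrow> s \<in> inner p)"
    by metis
  have "inj_on w Ps"
  proof (rule inj_onI, rule ccontr)
    fix p q assume pq: "p \<in> Ps" "q \<in> Ps" "w p = w q" "p \<noteq> q"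
    show False
    proof (cases "w q")
      case (Inl e)
      then have "e \<in> path_edges p \<inter> path_edges q" using w(2)[OF pq(1)] w(2)[OF pq(2)] pq(3) by simp
      then show False using edge_disj[OF pq(1,2,4)] by blast
    next
      case (Inr s)
      then have "s \<in> inner p \<inter> inner q" using w(2)[OF pq(1)] w(2)[OF pq(2)] pq(3) by simp
      then show False using Ps(3)[OF pq(1,2,4)] by blast
    qed
  qed
  moreover have "w ` Ps \<subseteq> Inl ` F \<union> Inr ` S" using w(1) by blast
  moreover have "finite (Inl ` F \<union> Inr ` S)" using FS by simp
  ultimately show False using Ps(1) by (meson finite_imageD finite_subset)
qed (use wf con in auto)

section \<open>Subdivisions\<close>

text \<open>The path system, existentially quantified in \<open>subdivision_of\<close>, becomes a
  parameter, so that different lemmas refer to the same path for an edge.\<close>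

locale subdivision =
  fixes G \<Gamma> :: "'a graph" and P :: "'a set \<Rightarrow> 'a list"
  assumes wf_\<Gamma>: "wf_graph \<Gamma>"
    and path: "e \<in> edges \<Gamma> \<Longrightarrow> gpath G (P e)"
    and ends: "e \<in> edges \<Gamma> \<Longrightarrow> {hd (P e), last (P e)} = e"
    and inner_new: "e \<in> edges \<Gamma> \<Longrightarrow> inner (P e) \<inter> verts \<Gamma> = {}"
    and inner_disjoint:
      "e \<in> edges \<Gamma> \<Longrightarrow> e' \<in> edges \<Gamma> \<Longrightarrow> e \<noteq> e' \<Longrightarrow> inner (P e) \<inter> inner (P e') = {}"
    and verts_eq: "verts G = verts \<Gamma> \<union> (\<Union>e\<in>edges \<Gamma>. inner (P e))"
    and edges_eq: "edges G = (\<Union>e\<in>edges \<Gamma>. path_edges (P e))"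
begin

lemma edge_subset: "e \<in> edges \<Gamma> \<Longrightarrow> e \<subseteq> verts \<Gamma>"
  and edge_card: "e \<in> edges \<Gamma> \<Longrightarrow> card e = 2"
  using wf_\<Gamma> by (auto simp: wf_graph_def)

lemma wf_G: "wf_graph G"
proof -
  have "card f = 2 \<and> f \<subseteq> verts G" if "e \<in> edges \<Gamma>" "f \<in> path_edges (P e)" for e f
    using path[OF that(1)] card_path_edge[of "P e" f] path_edges_subset[OF that(2)] that(2)
    by (auto simp: gpath_def)
  then show ?thesis by (auto simp: wf_graph_def edges_eq)
qed

lemma subdivision_of: "subdivision_of G \<Gamma>"
  unfolding subdivision_of_def
  by (intro conjI exI[of _ P] ballI impI)
    (use wf_G wf_\<Gamma> path ends inner_new inner_disjoint verts_eq edges_eq in simp_all)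

lemma set_path: "e \<in> edges \<Gamma> \<Longrightarrow> set (P e) = e \<union> inner (P e)"
proof -
  assume e: "e \<in> edges \<Gamma>"
  have "hd (P e) \<noteq> last (P e)"
    using ends[OF e] edge_card[OF e] by (metis card_2_iff doubleton_eq_iff insert_absorb2)
  then show ?thesis
    using set_eq_ends_inner[of "P e" "hd (P e)" "last (P e)"] path[OF e] ends[OF e]
    by (simp add: gpath_def)
qed

text \<open>Both vertices of a common edge \<open>f\<close> lie on both paths, hence are common
  ends. So \<open>f\<close> is contained in \<open>e\<close> and in \<open>e'\<close>, and all three
  have two elements.\<close>

lemma path_edges_disjoint:
  assumes e: "e \<in> edges \<Gamma>" "e' \<in> edges \<Gamma>" and f: "f \<in> path_edges (P e)" "f \<in> path_edges (P e')"
  shows "e = e'"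
proof (rule ccontr)
  assume ne: "e \<noteq> e'"
  have "f \<subseteq> e \<inter> e'"
    using path_edges_subset[OF f(1)] path_edges_subset[OF f(2)] set_path[OF e(1)] set_path[OF e(2)]
      inner_new[OF e(1)] inner_new[OF e(2)] inner_disjoint[OF e ne]
      edge_subset[OF e(1)] edge_subset[OF e(2)] by blast
  moreover have "card f = 2" using card_path_edge[OF _ f(1)] path[OF e(1)] by (simp add: gpath_def)
  ultimately have "f = e" "f = e'"
    using card_seteq[of e f] card_seteq[of e' f] edge_card[OF e(1)] edge_card[OF e(2)]
      card.infinite by fastforce+
  then show False using ne by simp
qed

lemma path_unique_of_inner:
  assumes "e \<in> edges \<Gamma>" "e' \<in> edges \<Gamma>" "w \<in> inner (P e)" "w \<in> set (P e')"
  shows "e = e'"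
  using assms set_path[OF assms(2)] inner_new[OF assms(1)] inner_disjoint[OF assms(1,2)]
    edge_subset[OF assms(2)] by blast

text \<open>Each step along an edge of \<open>E'\<close> is replaced by its path. The set
  \<open>S\<close> may contain branch vertices: the ends of the path avoid \<open>S\<close> because
  the step does.\<close>

lemma reach_lift:
  assumes E': "E' \<subseteq> edges \<Gamma>"
    and "\<And>e. e \<in> E' \<Longrightarrow> path_edges (P e) \<inter> F = {} \<and> inner (P e) \<inter> S = {}"
    and ab: "(a, b) \<in> reach E' S"
  shows "(a, b) \<in> reach (edges G - F) S"
proof -
  have "b \<in> {b. (a, b) \<in> reach (edges G - F) S}"
    using ab
  proof (rule reach_closed)
    fix c d assume cd: "c \<in> {b. (a, b) \<in> reach (edges G - F) S}" "{c, d} \<in> E'" "c \<notin> S" "d \<notin> S"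
    let ?p = "P {c, d}"
    have e: "{c, d} \<in> edges \<Gamma>" using E' cd by blast
    have avoid: "path_edges ?p \<inter> F = {}" "inner ?p \<inter> S = {}" using assms(2)[OF cd(2)] by auto
    have 1: "path_edges ?p \<subseteq> edges G - F" using path[OF e] avoid by (auto simp: gpath_iff)
    have 2: "set ?p \<inter> S = {}" using set_path[OF e] avoid cd by auto
    have "(hd ?p, c) \<in> reach (edges G - F) S" "(hd ?p, d) \<in> reach (edges G - F) S"
      using path_reach[OF 1 2] set_path[OF e] by auto
    then show "d \<in> {b. (a, b) \<in> reach (edges G - F) S}"
      using cd(1) reach_sym reach_trans by (metis mem_Collect_eq)
  qed simp
  then show ?thesis by simp
qed

text \<open>Paths of different edges are edge-disjoint, so choosing for each path an element of
  \<open>F\<close> on it is injective.\<close>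

lemma finite_hit_edges:
  assumes "finite F"
  shows "finite {e \<in> edges \<Gamma>. path_edges (P e) \<inter> F \<noteq> {}}" (is "finite ?A")
proof -
  define g where "g e = (SOME f. f \<in> path_edges (P e) \<inter> F)" for e
  have g: "g e \<in> path_edges (P e) \<inter> F" if "e \<in> ?A" for e
    unfolding g_def by (rule someI_ex) (use that in blast)
  have "inj_on g ?A"
    by (rule inj_onI) (metis (no_types, lifting) g IntD1 mem_Collect_eq path_edges_disjoint)
  moreover have "g ` ?A \<subseteq> F" using g by blast
  ultimately show ?thesis using assms by (meson finite_imageD finite_subset)
qed

lemma finite_hit_inner:
  assumes "finite S"
  shows "finite {e \<in> edges \<Gamma>. inner (P e) \<inter> S \<noteq> {}}" (is "finite ?A")
proof -
  define g where "g e = (SOME f. f \<in> inner (P e) \<inter> S)" for e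
  have g: "g e \<in> inner (P e) \<inter> S" if "e \<in> ?A" for e
    unfolding g_def by (rule someI_ex) (use that in blast)
  have "inj_on g ?A"
  proof (rule inj_onI, rule ccontr)
    fix e e' assume "e \<in> ?A" "e' \<in> ?A" "g e = g e'" "e \<noteq> e'"
    then show False using g[of e] g[of e'] inner_disjoint[of e e'] by auto
  qed
  moreover have "g ` ?A \<subseteq> S" using g by blast
  ultimately show ?thesis using assms by (meson finite_imageD finite_subset)
qed

lemma reach_branch_vertices:
  assumes con: "inf_edge_connected \<Gamma>" and "finite F" "a \<in> verts \<Gamma>" "b \<in> verts \<Gamma>"
  shows "(a, b) \<in> reach (edges G - F) {}"
proof -
  let ?A = "{e \<in> edges \<Gamma>. path_edges (P e) \<inter> F \<noteq> {}}"
  have "(a, b) \<in> reach (edges \<Gamma> - ?A) {}"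
    using con finite_hit_edges[OF assms(2)] assms(3,4)
    unfolding inf_edge_connected_def connected_graph_def adj_rtrancl_eq_reach by simp
  then show ?thesis by (rule reach_lift[rotated 2]) auto
qed

lemma finitely_separable_of_subdivision:
  assumes "finitely_separable G"
  shows "finitely_separable \<Gamma>"
  unfolding finitely_separable_def
proof (intro ballI impI)
  fix x y assume xy: "x \<in> verts \<Gamma>" "y \<in> verts \<Gamma>" "x \<noteq> y"
  then have "x \<in> verts G" "y \<in> verts G" using verts_eq by auto
  then obtain F S where FS: "finite F" "finite S" "x \<notin> S" "y \<notin> S" "(x, y) \<notin> reach (edges G - F) S"
    using finitely_separableE[OF assms _ _ xy(3)] by metis
  \<comment> \<open>Hitting a path in an edge or in an inner vertex amounts to deleting the
    corresponding edge of \<Gamma>. Branch vertices in \<open>S\<close> stay deleted as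
    vertices.\<close>
  let ?A = "{e \<in> edges \<Gamma>. path_edges (P e) \<inter> F \<noteq> {}} \<union> {e \<in> edges \<Gamma>. inner (P e) \<inter> S \<noteq> {}}"
  have "(x, y) \<notin> reach (edges \<Gamma> - ?A) S"
  proof
    assume "(x, y) \<in> reach (edges \<Gamma> - ?A) S"
    then have "(x, y) \<in> reach (edges G - F) S" by (rule reach_lift[rotated 2]) auto
    then show False using FS(5) by simp
  qed
  moreover have "finite ?A" using finite_hit_edges finite_hit_inner FS by auto
  ultimately show "\<exists>F S. finite F \<and> finite S \<and> x \<notin> S \<and> y \<notin> S \<and> (x, y) \<notin> reach (edges \<Gamma> - F) S"
    using FS(2-4) by (intro exI[of _ ?A] exI[of _ S] conjI)
qed

text \<open>An inner vertex lies on no other path, so all its edges belong to one finite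
  path.\<close>

lemma finite_degree_inner:
  assumes "e \<in> edges \<Gamma>" "w \<in> inner (P e)"
  shows "finite {f \<in> edges G. w \<in> f}"
proof (rule finite_subset[OF _ finite_path_edges[of "P e"]], rule subsetI)
  fix f assume "f \<in> {f \<in> edges G. w \<in> f}"
  then obtain e' where e': "e' \<in> edges \<Gamma>" "f \<in> path_edges (P e')" "w \<in> f"
    by (auto simp: edges_eq)
  then have "w \<in> set (P e')" using path_edges_subset by blast
  then show "f \<in> path_edges (P e)" using path_unique_of_inner[OF assms(1) e'(1) assms(2)] e'(2) by simp
qed

text \<open>An inner vertex is cut off by deleting its finitely many edges. For two branch vertices,
  a separator in \<Gamma> is transferred by replacing each deleted edge with all edges of its
  path.\<close>

lemma finitely_separable_subdivision:
  assumes "finitely_separable \<Gamma>"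
  shows "finitely_separable G"
  unfolding finitely_separable_def
proof (intro ballI impI)
  fix x y assume xy: "x \<in> verts G" "y \<in> verts G" "x \<noteq> y"
  let ?goal = "\<lambda>x y. \<exists>F S. finite F \<and> finite S \<and> x \<notin> S \<and> y \<notin> S \<and> (x, y) \<notin> reach (edges G - F) S"
  have inner_case: "?goal x y" if "x \<in> verts G - verts \<Gamma>" "x \<noteq> y" for x y
  proof -
    let ?F = "{f \<in> edges G. x \<in> f}"
    have "(x, y) \<notin> reach (edges G - ?F) {}"
      using reach_closed[of x y "edges G - ?F" "{}" "{x}"] that(2) by auto
    moreover have "finite ?F" using that(1) finite_degree_inner by (auto simp: verts_eq)
    ultimately show ?thesis by blast
  qed
  consider "x \<notin> verts \<Gamma>" | "y \<notin> verts \<Gamma>" | "x \<in> verts \<Gamma>" "y \<in> verts \<Gamma>" by blast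
  then show "?goal x y"
  proof cases
    case 1
    then show ?thesis using inner_case xy by blast
  next
    case 2
    then have "?goal y x" using inner_case[of y x] xy by blast
    then show ?thesis using reach_sym by metis
  next
    case 3
    then obtain F S where FS: "finite F" "finite S" "x \<notin> S" "y \<notin> S"
      "(x, y) \<notin> reach (edges \<Gamma> - F) S"
      using finitely_separableE[OF assms _ _ xy(3)] by metis
    let ?F = "\<Union>e\<in>F. path_edges (P e)"
    define R where "R = {b \<in> verts \<Gamma>. (x, b) \<in> reach (edges \<Gamma> - F) S}"
    \<comment> \<open>The interior of every path with an end in \<open>R\<close> is included, even
      if the path is deleted or its other end lies in \<open>S\<close>. Hence closure under steps is
      only at stake at branch vertices, where it is inherited from \<open>R\<close>.\<close>
    define R' where "R' = R \<union> (\<Union>e\<in>{e \<in> edges \<Gamma>. e \<inter> R \<noteq> {}}. inner (P e))"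
    have step: "d \<in> R" if "c \<in> R" "c \<notin> S" "d \<notin> S" "e \<in> edges \<Gamma> - F" "c \<in> e" "d \<in> e" for c d e
    proof (cases "c = d")
      case False
      then have "e = {c, d}"
        using card_seteq[of e "{c, d}"] that edge_card[of e] card.infinite by fastforce
      then have "(c, d) \<in> reach (edges \<Gamma> - F) S" using that by (intro reach_edge) auto
      then show ?thesis using that edge_subset unfolding R_def by (blast intro: reach_trans)
    qed (use that in simp)
    have R_S: "c \<notin> S" if "c \<in> R" for c
      using that FS(3) reach_avoids[of x c _ S] by (auto simp: R_def)
    have "y \<in> R'" if "(x, y) \<in> reach (edges G - ?F) S"
      using that
    proof (rule reach_closed)
      show "x \<in> R'" using 3 by (simp add: R'_def R_def)
    next
      fix c d assume cd: "c \<in> R'" "{c, d} \<in> edges G - ?F" "c \<notin> S" "d \<notin> S"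
      then obtain e where e: "e \<in> edges \<Gamma> - F" "{c, d} \<in> path_edges (P e)" by (auto simp: edges_eq)
      have in_path: "c \<in> set (P e)" "d \<in> set (P e)" using path_edges_subset[OF e(2)] by auto
      have "e \<inter> R \<noteq> {}"
      proof (cases "c \<in> R")
        case True
        then have "c \<in> e" using in_path(1) set_path[of e] inner_new[of e] e(1) by (auto simp: R_def)
        then show ?thesis using True by blast
      next
        case False
        then obtain e' where "e' \<in> edges \<Gamma>" "e' \<inter> R \<noteq> {}" "c \<in> inner (P e')"
          using cd(1) by (auto simp: R'_def)
        then show ?thesis using path_unique_of_inner[of e' e c] in_path(1) e(1) by auto
      qed
      then obtain c' where c': "c' \<in> e" "c' \<in> R" by blast
      show "d \<in> R'"
      proof (cases "d \<in> e")
        case True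
        then show ?thesis using step[OF c'(2) R_S[OF c'(2)] cd(4) e(1) c'(1)] by (simp add: R'_def)
      next
        case False
        then have "d \<in> inner (P e)" using in_path(2) set_path[of e] e(1) by blast
        then show ?thesis using c' e(1) by (auto simp: R'_def)
      qed
    qed
    moreover have "y \<notin> R'" using 3 FS(5) inner_new by (auto simp: R'_def R_def)
    moreover have "finite ?F" using FS(1) finite_path_edges by blast
    ultimately show ?thesis using FS by blast
  qed
qed

end

lemma subdivision_ofE:
  assumes "subdivision_of G \<Gamma>"
  obtains P where "subdivision G \<Gamma> P"
proof -
  from assms obtain P where P:
    "\<forall>e\<in>edges \<Gamma>. gpath G (P e) \<and> {hd (P e), last (P e)} = e \<and> inner (P e) \<inter> verts \<Gamma> = {}"
    "\<forall>e\<in>edges \<Gamma>. \<forall>e'\<in>edges \<Gamma>. e \<noteq> e' \<longrightarrow> inner (P e) \<inter> inner (P e') = {}"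
    "verts G = verts \<Gamma> \<union> (\<Union>e\<in>edges \<Gamma>. inner (P e))"
    "edges G = (\<Union>e\<in>edges \<Gamma>. path_edges (P e))"
    unfolding subdivision_of_def by (elim conjE exE)
  have "subdivision G \<Gamma> P"
    by unfold_locales (use assms P in \<open>simp_all add: subdivision_of_def\<close>)
  then show thesis by (rule that)
qed

section \<open>Contractions\<close>

text \<open>The quotient map on vertices. An edge with an end outside \<open>X\<close> is sent to an
  edge of the contraction, an edge inside \<open>X\<close> collapses to \<open>{X}\<close>.\<close>

definition proj :: "'a set \<Rightarrow> 'a \<Rightarrow> 'a set" where
  "proj X w = (if w \<in> X then X else {w})"

lemma proj_simps [simp]: "w \<in> X \<Longrightarrow> proj X w = X" "w \<notin> X \<Longrightarrow> proj X w = {w}"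
  by (simp_all add: proj_def)

lemma singleton_neq [simp]: "w \<notin> X \<Longrightarrow> {w} \<noteq> X" "w \<notin> X \<Longrightarrow> X \<noteq> {w}"
  by auto

lemma wf_contract:
  assumes "wf_graph H"
  shows "wf_graph (contract H X)"
  unfolding wf_graph_def
proof
  fix e assume "e \<in> edges (contract H X)"
  then consider a b where "e = {{a}, {b}}" "{a, b} \<in> edges H" "a \<notin> X" "b \<notin> X"
    | w where "e = {X, {w}}" "w \<in> verts H - X"
    by (auto simp: contract_def)
  then show "card e = 2 \<and> e \<subseteq> verts (contract H X)"
  proof cases
    case 1
    then have "card {a, b} = 2" "{a, b} \<subseteq> verts H" using assms by (auto simp: wf_graph_def)
    moreover from this have "a \<noteq> b" by auto
    ultimately show ?thesis using 1 by (simp add: contract_def)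
  next
    case 2
    then show ?thesis by (simp add: contract_def)
  qed
qed

lemma edges_contract_outside:
  assumes "c \<notin> X" "d \<notin> X"
  shows "{{c}, {d}} \<in> edges (contract H X) \<longleftrightarrow> {c, d} \<in> edges H"
  using assms by (auto simp: contract_def doubleton_eq_iff insert_commute)

lemma edges_contract_new:
  assumes "wf_graph H" "c \<notin> X"
  shows "{X, {c}} \<in> edges (contract H X) \<longleftrightarrow> (\<exists>x\<in>X. {x, c} \<in> edges H)"
  using assms by (auto simp: contract_def doubleton_eq_iff wf_graph_def)

lemma contract_step_cases:
  assumes "{{c}, D} \<in> edges (contract H X)" "c \<notin> X"
  obtains d where "D = {d}" "d \<notin> X" "{c, d} \<in> edges H"
    | x where "D = X" "x \<in> X" "{c, x} \<in> edges H"
  using assms by (auto simp: contract_def doubleton_eq_iff insert_commute)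

text \<open>An old vertex is separated from \<open>X\<close> by combining separators from each of
  the finitely many \<open>x \<in> X\<close>. Two old vertices are separated by a separator in
  \<open>H\<close> with the contracted vertex \<open>X\<close> added to the deleted
  vertices.\<close>

lemma finitely_separable_contract:
  assumes sep: "finitely_separable H" and X: "finite X" "X \<subseteq> verts H"
  shows "finitely_separable (contract H X)"
  unfolding finitely_separable_def
proof (intro ballI impI)
  fix p q assume pq: "p \<in> verts (contract H X)" "q \<in> verts (contract H X)" "p \<noteq> q"
  let ?E = "edges (contract H X)"
  let ?goal = "\<lambda>p q. \<exists>F S. finite F \<and> finite S \<and> p \<notin> S \<and> q \<notin> S \<and> (p, q) \<notin> reach (?E - F) S"
  have new: "?goal {a} X" if a: "a \<in> verts H" "a \<notin> X" for a
  proof -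
    have "\<exists>F S. finite F \<and> finite S \<and> a \<notin> S \<and> x \<notin> S \<and> (a, x) \<notin> reach (edges H - F) S"
      if "x \<in> X" for x
      using finitely_separableE[OF sep, of a x] a X that by (metis subsetD)
    then obtain F S where FS: "\<And>x. x \<in> X \<Longrightarrow> finite (F x)" "\<And>x. x \<in> X \<Longrightarrow> finite (S x)"
      "\<And>x. x \<in> X \<Longrightarrow> a \<notin> S x" "\<And>x. x \<in> X \<Longrightarrow> x \<notin> S x"
      "\<And>x. x \<in> X \<Longrightarrow> (a, x) \<notin> reach (edges H - F x) (S x)" by metis
    define F' where "F' = (\<Union>x\<in>X. (\<lambda>e. proj X ` e) ` F x)"
    define S' where "S' = (\<Union>x\<in>X. (\<lambda>w. {w}) ` (S x - X))"
    \<comment> \<open>Before a walk enters \<open>X\<close> it is a walk of \<open>H\<close>, and it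
      avoids all the separators simultaneously.\<close>
    define R where "R = {{c} | c. c \<notin> X \<and> (\<forall>x\<in>X. (a, c) \<in> reach (edges H - F x) (S x))}"
    have "X \<in> R" if "({a}, X) \<in> reach (?E - F') S'"
      using that
    proof (rule reach_closed)
      show "{a} \<in> R" using a by (simp add: R_def)
    next
      fix C D assume CD: "C \<in> R" "{C, D} \<in> ?E - F'" "C \<notin> S'" "D \<notin> S'"
      then obtain c where c: "C = {c}" "c \<notin> X"
        "\<And>x. x \<in> X \<Longrightarrow> (a, c) \<in> reach (edges H - F x) (S x)" by (auto simp: R_def)
      have c_S: "c \<notin> S x" if "x \<in> X" for x using c(3)[OF that] FS(3)[OF that] reach_avoids by metis
      have "{{c}, D} \<in> ?E" using CD c by simp
      then show "D \<in> R"
        using c(2)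
      proof (rule contract_step_cases)
        fix d assume d: "D = {d}" "d \<notin> X" "{c, d} \<in> edges H"
        have "(a, d) \<in> reach (edges H - F x) (S x)" if x: "x \<in> X" for x
        proof -
          have "{c, d} \<notin> F x"
          proof
            assume "{c, d} \<in> F x"
            then have "proj X ` {c, d} \<in> F'" unfolding F'_def using x by blast
            then show False using CD c d by simp
          qed
          moreover have "d \<notin> S x" using CD(4) d x by (auto simp: S'_def)
          ultimately have "(c, d) \<in> reach (edges H - F x) (S x)"
            using d(3) c_S[OF x] by (intro reach_edge) auto
          then show ?thesis using c(3)[OF x] reach_trans by metis
        qed
        then show "D \<in> R" using d by (auto simp: R_def)
      next
        \<comment> \<open>Entering \<open>X\<close> at \<open>x\<close> is impossible, since it
          would extend the walk to one that violates the separator chosen for this very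
          \<open>x\<close>.\<close>
        fix x assume x: "D = X" "x \<in> X" "{c, x} \<in> edges H"
        have "{c, x} \<notin> F x"
        proof
          assume "{c, x} \<in> F x"
          then have "proj X ` {c, x} \<in> F'" unfolding F'_def using x by blast
          then show False using CD c x by simp
        qed
        then have "(c, x) \<in> reach (edges H - F x) (S x)"
          using x c_S FS(4) by (intro reach_edge) auto
        then show "D \<in> R" using c(3) x FS(5) reach_trans by metis
      qed
    qed
    moreover have "X \<notin> R" by (auto simp: R_def)
    moreover have "finite F'" "finite S'" using X FS by (auto simp: F'_def S'_def)
    moreover have "{a} \<notin> S'" "X \<notin> S'" using FS(3) by (auto simp: S'_def)
    ultimately show ?thesis by blast
  qed
  have old: "?goal {a} {b}" if ab: "a \<in> verts H" "a \<notin> X" "b \<in> verts H" "b \<notin> X" "a \<noteq> b" for a b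
  proof -
    obtain F S where FS: "finite F" "finite S" "a \<notin> S" "b \<notin> S" "(a, b) \<notin> reach (edges H - F) S"
      using finitely_separableE[OF sep ab(1,3,5)] .
    define F' where "F' = (\<lambda>e. (\<lambda>w. {w}) ` e) ` F"
    \<comment> \<open>With \<open>X\<close> deleted, walks in the contraction use old vertices only
      and lift to \<open>H\<close> unchanged.\<close>
    define S' where "S' = insert X ((\<lambda>w. {w}) ` (S - X))"
    have "{b} \<in> {{c} | c. c \<notin> X \<and> (a, c) \<in> reach (edges H - F) S}"
      if "({a}, {b}) \<in> reach (?E - F') S'"
      using that
    proof (rule reach_closed)
      fix C D assume CD: "C \<in> {{c} | c. c \<notin> X \<and> (a, c) \<in> reach (edges H - F) S}"
        "{C, D} \<in> ?E - F'" "C \<notin> S'" "D \<notin> S'"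
      then obtain c where c: "C = {c}" "c \<notin> X" "(a, c) \<in> reach (edges H - F) S" by auto
      have "{{c}, D} \<in> ?E" using CD c by simp
      then obtain d where d: "D = {d}" "d \<notin> X" "{c, d} \<in> edges H"
        using c(2) by (rule contract_step_cases) (use CD(4) in \<open>auto simp: S'_def\<close>)
      have "{c, d} \<notin> F"
      proof
        assume "{c, d} \<in> F"
        then have "(\<lambda>w. {w}) ` {c, d} \<in> F'" unfolding F'_def by blast
        then show False using CD c d by simp
      qed
      moreover have "d \<notin> S" using CD(4) d by (auto simp: S'_def)
      moreover have "c \<notin> S" using c(3) FS(3) reach_avoids by metis
      ultimately have "(c, d) \<in> reach (edges H - F) S" using d(3) by (intro reach_edge) auto
      then have "(a, d) \<in> reach (edges H - F) S" using c(3) reach_trans by metis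
      then show "D \<in> {{c} | c. c \<notin> X \<and> (a, c) \<in> reach (edges H - F) S}" using d by blast
    qed (use ab in auto)
    then have "({a}, {b}) \<notin> reach (?E - F') S'" using FS(5) by auto
    moreover have "finite F'" "finite S'" using FS by (auto simp: F'_def S'_def)
    moreover have "{a} \<notin> S'" "{b} \<notin> S'" using FS ab by (auto simp: S'_def)
    ultimately show ?thesis by blast
  qed
  consider a where "p = {a}" "a \<in> verts H" "a \<notin> X" "q = X"
    | b where "q = {b}" "b \<in> verts H" "b \<notin> X" "p = X"
    | a b where "p = {a}" "a \<in> verts H" "a \<notin> X" "q = {b}" "b \<in> verts H" "b \<notin> X" "a \<noteq> b"
    using pq by (auto simp: contract_def)
  then show "?goal p q"
  proof cases
    case 1
    then show ?thesis using new by simp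
  next
    case 2
    then have "?goal q p" using new by simp
    then show ?thesis using reach_sym by metis
  next
    case 3
    then show ?thesis using old by simp
  qed
qed

section \<open>Subdivided \<Pi>-graphs inside an edge-connectivity class\<close>

definition link :: "'a list \<Rightarrow> 'a set" where
  "link l = {hd l, last l}"

text \<open>The direct connections of the overview; distinct ends make \<open>link l\<close> a
  possible edge of a simple graph.\<close>

definition linking_path :: "'a set \<Rightarrow> 'a set set \<Rightarrow> 'a list \<Rightarrow> bool" where
  "linking_path U E l \<longleftrightarrow> l \<noteq> [] \<and> distinct l \<and> path_edges l \<subseteq> E \<and> hd l \<noteq> last l \<and>
     link l \<subseteq> U \<and> inner l \<inter> U = {}"

text \<open>The path system of a subdivision under construction. Distinct links ensure that each
  edge of the subdivided simple graph has exactly one path.\<close>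

definition linkage :: "'a set \<Rightarrow> 'a set set \<Rightarrow> 'a list set \<Rightarrow> bool" where
  "linkage U E \<L> \<longleftrightarrow> (\<forall>l\<in>\<L>. linking_path U E l) \<and>
     (\<forall>l\<in>\<L>. \<forall>l'\<in>\<L>. l \<noteq> l' \<longrightarrow> inner l \<inter> inner l' = {} \<and> link l \<noteq> link l')"

lemma linkageD:
  assumes "linkage U E \<L>"
  shows "l \<in> \<L> \<Longrightarrow> linking_path U E l"
    and "l \<in> \<L> \<Longrightarrow> l' \<in> \<L> \<Longrightarrow> l \<noteq> l' \<Longrightarrow> inner l \<inter> inner l' = {}"
    and "l \<in> \<L> \<Longrightarrow> l' \<in> \<L> \<Longrightarrow> l \<noteq> l' \<Longrightarrow> link l \<noteq> link l'"
  using assms unfolding linkage_def by simp_all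

lemma linkage_Un:
  assumes "linkage U E \<K>" "linkage U E \<L>"
    and "\<And>k l. k \<in> \<K> \<Longrightarrow> l \<in> \<L> \<Longrightarrow> inner k \<inter> inner l = {} \<and> link k \<noteq> link l"
  shows "linkage U E (\<K> \<union> \<L>)"
  unfolding linkage_def
proof (intro conjI ballI impI)
  fix l assume "l \<in> \<K> \<union> \<L>"
  then show "linking_path U E l" using assms(1,2) linkageD(1) by blast
next
  fix k l assume kl: "k \<in> \<K> \<union> \<L>" "l \<in> \<K> \<union> \<L>" "k \<noteq> l"
  show "inner k \<inter> inner l = {}"
    using kl linkageD(2)[OF assms(1), of k l] linkageD(2)[OF assms(2), of k l]
      assms(3)[of k l] assms(3)[of l k] by (auto simp: Int_commute)
  show "link k \<noteq> link l"
    using kl linkageD(3)[OF assms(1), of k l] linkageD(3)[OF assms(2), of k l]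
      assms(3)[of k l] assms(3)[of l k] by auto
qed

lemma set_linking_path: "linking_path U E l \<Longrightarrow> set l = link l \<union> inner l"
  unfolding linking_path_def link_def by (metis set_eq_ends_inner)

text \<open>The path is cut at each of its vertices in \<open>U\<close>. The induction splits off
  the segment up to the first return to \<open>U\<close>; the link of this segment differs from all
  later ones because \<open>hd p\<close> does not occur on the rest.\<close>

lemma path_decomposition:
  assumes "p \<noteq> []" "distinct p" "path_edges p \<subseteq> E" "hd p \<in> U" "last p \<in> U"
  shows "\<exists>\<L>. finite \<L> \<and> linkage U E \<L> \<and> (\<forall>l\<in>\<L>. set l \<subseteq> set p) \<and>
    (hd p, last p) \<in> reach (link ` \<L>) {}"
  using assms
proof (induction p rule: length_induct)
  case (1 p)
  then obtain a r where p: "p = a # r" by (cases p) auto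
  show ?case
  proof (cases "r = []")
    case True
    then show ?thesis using p by (intro exI[of _ "{}"]) (auto simp: linkage_def)
  next
    case False
    then have "\<exists>c\<in>set r. c \<in> U" using 1(6) p by (metis last_ConsR last_in_set)
    then obtain m c s where r: "r = m @ c # s" "c \<in> U" "\<forall>d\<in>set m. d \<notin> U"
      using split_list_first_prop[of r "\<lambda>c. c \<in> U"] by blast
    let ?l = "a # m @ [c]"
    have pe: "path_edges p = path_edges ?l \<union> path_edges (c # s)"
      using path_edges_append[of "a # m" c s] p r by simp
    have "length (c # s) < length p" using p r by simp
    moreover have "distinct (c # s)" "path_edges (c # s) \<subseteq> E" "last (c # s) = last p"
      using 1 p r pe by auto
    ultimately obtain \<L> where \<L>: "finite \<L>" "linkage U E \<L>" "\<And>l. l \<in> \<L> \<Longrightarrow> set l \<subseteq> set (c # s)"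
      "(c, last p) \<in> reach (link ` \<L>) {}"
      using 1(1,6) r(2) by (metis list.distinct(1) list.sel(1))
    have l: "linking_path U E ?l"
      using 1 p r pe by (auto simp: linking_path_def link_def)
    have "linkage U E ({?l} \<union> \<L>)"
    proof (rule linkage_Un)
      show "linkage U E {?l}" using l by (simp add: linkage_def)
      show "linkage U E \<L>" by fact
      fix k l' assume k: "k \<in> {?l}" and l': "l' \<in> \<L>"
      have s: "set l' = link l' \<union> inner l'"
        using linkageD(1)[OF \<L>(2) l'] by (rule set_linking_path)
      have "a \<notin> set (c # s)" "set m \<inter> set (c # s) = {}" using 1(3) p r by auto
      then have "a \<notin> link l'" "set m \<inter> inner l' = {}" using \<L>(3)[OF l'] s by auto
      then show "inner k \<inter> inner l' = {} \<and> link k \<noteq> link l'" using k by (auto simp: link_def)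
    qed
    moreover have "set l \<subseteq> set p" if "l \<in> {?l} \<union> \<L>" for l using that \<L>(3) p r by auto
    moreover have "(a, last p) \<in> reach (link ` ({?l} \<union> \<L>)) {}"
    proof (rule reach_trans)
      show "(a, c) \<in> reach (link ` ({?l} \<union> \<L>)) {}" by (rule reach_edge) (auto simp: link_def)
      show "(c, last p) \<in> reach (link ` ({?l} \<union> \<L>)) {}" by (rule reach_mono[OF \<L>(4)]) auto
    qed
    ultimately show ?thesis using \<L>(1) p
      by (intro exI[of _ "{?l} \<union> \<L>"]) simp
  qed
qed

locale edge_class =
  fixes H :: "'a graph" and x :: 'a
  assumes wf: "wf_graph H" and separable: "finitely_separable H" and x_vert: "x \<in> verts H"
begin

definition U :: "'a set" where
  "U = {z \<in> verts H. \<forall>F. finite F \<longrightarrow> (x, z) \<in> reach (edges H - F) {}}"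

abbreviation "links \<equiv> linkage U (edges H)"

lemma x_in_U: "x \<in> U"
  using x_vert by (simp add: U_def)

lemma reach_verts: "(a, b) \<in> reach E S \<Longrightarrow> E \<subseteq> edges H \<Longrightarrow> a \<in> verts H \<Longrightarrow> b \<in> verts H"
  by (rule reach_closed) (use wf in \<open>auto simp: wf_graph_def subset_iff\<close>)

lemma reach_U: "a \<in> U \<Longrightarrow> finite F \<Longrightarrow> (x, a) \<in> reach (edges H - F) {}"
  by (simp add: U_def)

lemma cut_off:
  assumes "w \<notin> U"
  shows "\<exists>F. finite F \<and> (x, w) \<notin> reach (edges H - F) {}"
proof (rule ccontr)
  assume neg: "\<not> ?thesis"
  then have "(x, w) \<in> reach (edges H - {}) {}" by blast
  then have "w \<in> verts H" using reach_verts[of x w "edges H - {}" "{}"] x_vert by simp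
  then show False using neg assms by (simp add: U_def)
qed

text \<open>A separator of \<open>a\<close> and \<open>b\<close> may delete vertices, but its
  vertices in \<open>U\<close> cannot lie on a linking path from \<open>a\<close> to
  \<open>b\<close>. The others are replaced by finite edge cuts.\<close>

lemma cut_links:
  assumes ab: "a \<in> U" "b \<in> U" "a \<noteq> b"
  shows "\<exists>F. finite F \<and> (\<forall>l. linking_path U (edges H - F) l \<longrightarrow> link l \<noteq> {a, b})"
proof -
  obtain F S where FS: "finite F" "finite S" "a \<notin> S" "b \<notin> S" "(a, b) \<notin> reach (edges H - F) S"
    using finitely_separableE[OF separable _ _ ab(3)] ab(1,2) by (auto simp: U_def)
  obtain cut where cut: "\<And>w. w \<notin> U \<Longrightarrow> finite (cut w)"
    "\<And>w. w \<notin> U \<Longrightarrow> (x, w) \<notin> reach (edges H - cut w) {}" using cut_off by metis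
  \<comment> \<open>A direct connection avoiding \<open>?F\<close> would have to meet \<open>S\<close> in a vertex cut off from \<open>U\<close>.\<close>
  let ?F = "F \<union> (\<Union>s\<in>S - U. cut s)"
  have "link l \<noteq> {a, b}" if l: "linking_path U (edges H - ?F) l" for l
  proof
    assume eq: "link l = {a, b}"
    have pe: "path_edges l \<subseteq> edges H - ?F" using l by (simp add: linking_path_def)
    have set_l: "set l = {a, b} \<union> inner l" using set_linking_path[OF l] eq by simp
    show False
    proof (cases "set l \<inter> S = {}")
      case True
      have "(hd l, a) \<in> reach (edges H - ?F) S" "(hd l, b) \<in> reach (edges H - ?F) S"
        using path_reach[OF pe True] set_l by auto
      then have "(a, b) \<in> reach (edges H - ?F) S" using reach_sym reach_trans by metis
      then have "(a, b) \<in> reach (edges H - F) S" by (rule reach_mono) auto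
      then show False using FS by simp
    next
      case False
      then obtain s where s: "s \<in> set l" "s \<in> S" by blast
      then have "s \<notin> U" using set_l FS l by (auto simp: linking_path_def)
      have pe': "path_edges l \<subseteq> edges H - cut s" using pe s \<open>s \<notin> U\<close> by blast
      have "(hd l, a) \<in> reach (edges H - cut s) {}" "(hd l, s) \<in> reach (edges H - cut s) {}"
        using path_reach[OF pe'] set_l s by auto
      moreover have "(x, a) \<in> reach (edges H - cut s) {}"
        using reach_U[OF ab(1)] cut(1)[OF \<open>s \<notin> U\<close>] by simp
      ultimately have "(x, s) \<in> reach (edges H - cut s) {}" using reach_sym reach_trans by metis
      then show False using cut(2)[OF \<open>s \<notin> U\<close>] by simp
    qed
  qed
  moreover have "finite ?F" using FS cut by simp
  ultimately show ?thesis by blast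
qed

text \<open>A finite edge set is deleted that rules out the links already present and cuts the used
  inner vertices off from \<open>x\<close>. As \<open>a\<close> lies in \<open>U\<close>, a path
  from \<open>x\<close> to \<open>a\<close> survives, and its decomposition at \<open>U\<close>
  supplies the new linking paths.\<close>

lemma add_links_to:
  assumes \<L>: "finite \<L>" "links \<L>" and a: "a \<in> U"
  shows "\<exists>\<K>. finite \<K> \<and> links (\<L> \<union> \<K>) \<and> link ` \<L> \<inter> link ` \<K> = {} \<and>
    (x, a) \<in> reach (link ` \<K>) {}"
proof -
  have "\<exists>F. finite F \<and> (\<forall>k. linking_path U (edges H - F) k \<longrightarrow> link k \<noteq> link l)" if "l \<in> \<L>" for l
    using linkageD(1)[OF \<L>(2) that] cut_links[of "hd l" "last l"]
    unfolding linking_path_def link_def by simp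
  then obtain F where F: "\<And>l. l \<in> \<L> \<Longrightarrow> finite (F l)"
    "\<And>l k. l \<in> \<L> \<Longrightarrow> linking_path U (edges H - F l) k \<Longrightarrow> link k \<noteq> link l"
    by metis
  obtain cut where cut: "\<And>w. w \<notin> U \<Longrightarrow> finite (cut w)"
    "\<And>w. w \<notin> U \<Longrightarrow> (x, w) \<notin> reach (edges H - cut w) {}" using cut_off by metis
  let ?W = "\<Union>l\<in>\<L>. inner l"
  have W: "finite ?W" "?W \<inter> U = {}"
    using \<L>(1) linkageD(1)[OF \<L>(2)] by (auto simp: inner_def linking_path_def)
  let ?F = "(\<Union>l\<in>\<L>. F l) \<union> (\<Union>w\<in>?W. cut w)"
  have "finite (\<Union>w\<in>?W. cut w)" using W cut(1) by blast
  then have "finite ?F" using \<L>(1) F(1) by simp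
  then have "(x, a) \<in> reach (edges H - ?F) {}" using reach_U[OF a] by simp
  then obtain p where p: "p \<noteq> []" "hd p = x" "last p = a" "distinct p" "path_edges p \<subseteq> edges H - ?F"
    by (rule reach_path) auto
  obtain \<K> where \<K>: "finite \<K>" "linkage U (edges H - ?F) \<K>" "\<And>k. k \<in> \<K> \<Longrightarrow> set k \<subseteq> set p"
    "(x, a) \<in> reach (link ` \<K>) {}"
    using path_decomposition[OF p(1,4,5), of U] p(2,3) x_in_U a by auto
  have mono: "linking_path U E k"
    if "linking_path U (edges H - ?F) k" "edges H - ?F \<subseteq> E" for k E
    using that by (auto simp: linking_path_def)
  have avoid: "w \<notin> set p" if "w \<in> ?W" for w
  proof
    assume w: "w \<in> set p"
    have "path_edges p \<subseteq> edges H - cut w" using p(5) that by blast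
    then have "(x, w) \<in> reach (edges H - cut w) {}" using path_reach[of p _ "{}" w] w p(2) by simp
    then show False using cut(2)[of w] W(2) that by blast
  qed
  have new: "link k \<noteq> link l" if "l \<in> \<L>" "k \<in> \<K>" for k l
    using F(2)[OF that(1)] mono[OF linkageD(1)[OF \<K>(2) that(2)], of "edges H - F l"] that(1) by blast
  have "links (\<L> \<union> \<K>)"
  proof (rule linkage_Un)
    show "links \<K>"
      using \<K>(2) mono unfolding linkage_def by (metis Diff_subset)
    fix l k assume lk: "l \<in> \<L>" "k \<in> \<K>"
    have "inner k \<subseteq> set p"
      using set_linking_path[OF linkageD(1)[OF \<K>(2) lk(2)]] \<K>(3)[OF lk(2)] by blast
    then show "inner l \<inter> inner k = {} \<and> link l \<noteq> link k" using avoid new[OF lk] lk(1) by blast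
  qed fact
  moreover have "link ` \<L> \<inter> link ` \<K> = {}" using new by force
  ultimately show ?thesis using \<K> by blast
qed

lemma add_links:
  assumes "finite A" "A \<subseteq> U" "finite \<L>" "links \<L>"
  shows "\<exists>\<K>. finite \<K> \<and> links (\<L> \<union> \<K>) \<and> link ` \<L> \<inter> link ` \<K> = {} \<and>
    (\<forall>a\<in>A. (x, a) \<in> reach (link ` \<K>) {})"
  using assms(1,2)
proof (induction A rule: finite_induct)
  case empty
  then show ?case using assms by (intro exI[of _ "{}"]) simp
next
  case (insert a A)
  then obtain \<K> where \<K>: "finite \<K>" "links (\<L> \<union> \<K>)" "link ` \<L> \<inter> link ` \<K> = {}"
    "\<And>a. a \<in> A \<Longrightarrow> (x, a) \<in> reach (link ` \<K>) {}" by auto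
  obtain \<M> where \<M>: "finite \<M>" "links (\<L> \<union> \<K> \<union> \<M>)" "link ` (\<L> \<union> \<K>) \<inter> link ` \<M> = {}"
    "(x, a) \<in> reach (link ` \<M>) {}"
    using add_links_to[of "\<L> \<union> \<K>" a] \<K>(1,2) assms(3) insert.prems by auto
  have "(x, b) \<in> reach (link ` (\<K> \<union> \<M>)) {}" if "b \<in> insert a A" for b
  proof (cases "b = a")
    case True
    show ?thesis unfolding True by (rule reach_mono[OF \<M>(4)]) auto
  next
    case False
    then have "b \<in> A" using that by simp
    show ?thesis by (rule reach_mono[OF \<K>(4)[OF \<open>b \<in> A\<close>]]) auto
  qed
  moreover have "links (\<L> \<union> (\<K> \<union> \<M>))" using \<M>(2) by (simp add: Un_assoc)
  moreover have "link ` \<L> \<inter> link ` (\<K> \<union> \<M>) = {}" using \<K>(3) \<M>(3) by blast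
  ultimately show ?case using \<K>(1) \<M>(1) by (intro exI[of _ "\<K> \<union> \<M>"]) simp
qed

text \<open>Links are distinct, so \<open>link\<close> is injective on the family and its inverse
  assigns each edge its path.\<close>

lemma subdivision_of_linkage:
  assumes "links \<L>"
  defines "\<Gamma> \<equiv> \<lparr>verts = \<Union>(link ` \<L>), edges = link ` \<L>\<rparr>"
    and "K \<equiv> \<lparr>verts = (\<Union>l\<in>\<L>. set l), edges = (\<Union>l\<in>\<L>. path_edges l)\<rparr>"
  shows "subdivision K \<Gamma> (inv_into \<L> link)" "subgraph K H"
proof -
  have inj: "inj_on link \<L>"
    using linkageD(3)[OF assms(1)] by (intro inj_onI) blast
  note [simp] = inv_into_f_f[OF inj]
  have lp: "l \<noteq> []" "distinct l" "path_edges l \<subseteq> edges H" "hd l \<noteq> last l" "link l \<subseteq> U"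
    "inner l \<inter> U = {}" "set l = link l \<union> inner l" if "l \<in> \<L>" for l
    using linkageD(1)[OF assms(1) that] set_linking_path[of U "edges H" l]
    by (simp_all add: linking_path_def)
  show sub: "subdivision K \<Gamma> (inv_into \<L> link)"
  proof
    show "wf_graph \<Gamma>"
      using lp(4) by (auto simp: \<Gamma>_def wf_graph_def link_def)
    show "verts K = verts \<Gamma> \<union> (\<Union>e\<in>edges \<Gamma>. inner (inv_into \<L> link e))"
      using lp(7) by (auto simp: K_def \<Gamma>_def)
    show "edges K = (\<Union>e\<in>edges \<Gamma>. path_edges (inv_into \<L> link e))"
      by (auto simp: K_def \<Gamma>_def)
  next
    fix e assume "e \<in> edges \<Gamma>"
    then obtain l where l: "l \<in> \<L>" "e = link l" by (auto simp: \<Gamma>_def)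
    show "gpath K (inv_into \<L> link e)" using l lp[OF l(1)] by (auto simp: gpath_iff K_def)
    have "inv_into \<L> link e = l" using l by simp
    then show "{hd (inv_into \<L> link e), last (inv_into \<L> link e)} = e" using l by (simp add: link_def)
    have "verts \<Gamma> \<subseteq> U" using lp(5) by (auto simp: \<Gamma>_def)
    then show "inner (inv_into \<L> link e) \<inter> verts \<Gamma> = {}" using l lp(6)[OF l(1)] by auto
  next
    fix e e' assume "e \<in> edges \<Gamma>" "e' \<in> edges \<Gamma>" "e \<noteq> e'"
    then obtain l l' where "l \<in> \<L>" "e = link l" "l' \<in> \<L>" "e' = link l'" "l \<noteq> l'"
      by (auto simp: \<Gamma>_def)
    then show "inner (inv_into \<L> link e) \<inter> inner (inv_into \<L> link e') = {}"
      using linkageD(2)[OF assms(1)] by simp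
  qed
  have "wf_graph K" using sub by (rule subdivision.wf_G)
  moreover have "set l \<subseteq> verts H" if "l \<in> \<L>" for l
  proof
    fix c assume "c \<in> set l"
    then have "(hd l, c) \<in> reach (edges H) {}" using path_reach[of l _ "{}"] lp(3)[OF that] by simp
    moreover have "hd l \<in> verts H" using lp(5)[OF that] by (auto simp: link_def U_def)
    ultimately show "c \<in> verts H" using reach_verts by blast
  qed
  ultimately show "subgraph K H" using lp(3) by (auto simp: subgraph_def K_def)
qed

text \<open>Starting from the single path \<open>[x, y]\<close>, each stage joins \<open>x\<close>
  to all branch vertices of the previous stage by links that are new. A finite edge set meets the
  links of the union in only finitely many, all present at some stage, so the next stage reconnects
  everything to \<open>x\<close>.\<close>

lemma ex_subdivided_pi:
  assumes y: "y \<in> U" "{x, y} \<in> edges H" "x \<noteq> y"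
  shows "\<exists>K B. subgraph K H \<and> subdivided_pi K B \<and> x \<in> B \<and> y \<in> B \<and> {x, y} \<in> edges K"
proof -
  have "\<exists>f. \<forall>n. (finite (f n) \<and> links (f n) \<and> [x, y] \<in> f n) \<and>
    (f n \<subseteq> f (Suc n) \<and> (\<forall>a\<in>\<Union>(link ` f n). (x, a) \<in> reach (link ` f (Suc n) - link ` f n) {}))"
  proof (rule dependent_nat_choice)
    have "linking_path U (edges H) [x, y]"
      using y x_in_U by (auto simp: linking_path_def link_def inner_def)
    then show "\<exists>\<L>. finite \<L> \<and> links \<L> \<and> [x, y] \<in> \<L>"
      by (intro exI[of _ "{[x, y]}"]) (simp add: linkage_def)
  next
    fix \<L> and n :: nat assume \<L>: "finite \<L> \<and> links \<L> \<and> [x, y] \<in> \<L>"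
    have "finite (\<Union>(link ` \<L>))" using \<L> by (auto simp: link_def)
    moreover have "\<Union>(link ` \<L>) \<subseteq> U" using \<L> by (auto simp: linkage_def linking_path_def)
    ultimately obtain \<K> where \<K>: "finite \<K>" "links (\<L> \<union> \<K>)" "link ` \<L> \<inter> link ` \<K> = {}"
      "\<forall>a\<in>\<Union>(link ` \<L>). (x, a) \<in> reach (link ` \<K>) {}"
      using add_links[of "\<Union>(link ` \<L>)" \<L>] \<L> by blast
    have "link ` \<K> \<subseteq> link ` (\<L> \<union> \<K>) - link ` \<L>" using \<K>(3) by blast
    then have "\<forall>a\<in>\<Union>(link ` \<L>). (x, a) \<in> reach (link ` (\<L> \<union> \<K>) - link ` \<L>) {}"
      using \<K>(4) reach_mono by (metis order_refl)
    then show "\<exists>\<L>'. (finite \<L>' \<and> links \<L>' \<and> [x, y] \<in> \<L>') \<and>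
      (\<L> \<subseteq> \<L>' \<and> (\<forall>a\<in>\<Union>(link ` \<L>). (x, a) \<in> reach (link ` \<L>' - link ` \<L>) {}))"
      using \<L> \<K>(1,2) by (intro exI[of _ "\<L> \<union> \<K>"]) simp
  qed
  then obtain f where f: "\<And>n. finite (f n)" "\<And>n. links (f n)" "\<And>n. [x, y] \<in> f n"
    "\<And>n. f n \<subseteq> f (Suc n)"
    "\<And>n a. a \<in> \<Union>(link ` f n) \<Longrightarrow> (x, a) \<in> reach (link ` f (Suc n) - link ` f n) {}" by metis
  have mono: "f m \<subseteq> f n" if "m \<le> n" for m n using lift_Suc_mono_le[of f] f(4) that by blast
  define \<L> where "\<L> = (\<Union>n. f n)"
  have link_in: "\<exists>n. l \<in> f n \<and> l' \<in> f n" if "l \<in> \<L>" "l' \<in> \<L>" for l l'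
  proof -
    obtain m n where "l \<in> f m" "l' \<in> f n" using \<open>l \<in> \<L>\<close> \<open>l' \<in> \<L>\<close> by (auto simp: \<L>_def)
    then show ?thesis using mono[of m "max m n"] mono[of n "max m n"] by auto
  qed
  have \<L>: "links \<L>"
    unfolding linkage_def
  proof (intro conjI ballI impI)
    fix l assume "l \<in> \<L>"
    then show "linking_path U (edges H) l" using f(2) linkageD(1) unfolding \<L>_def by blast
  next
    fix l l' assume l: "l \<in> \<L>" "l' \<in> \<L>" "l \<noteq> l'"
    then obtain n where n: "l \<in> f n" "l' \<in> f n" using link_in by blast
    show "inner l \<inter> inner l' = {}" using linkageD(2)[OF f(2) n l(3)] .
    show "link l \<noteq> link l'" using linkageD(3)[OF f(2) n l(3)] .
  qed
  define \<Gamma> where "\<Gamma> = \<lparr>verts = \<Union>(link ` \<L>), edges = link ` \<L>\<rparr>"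
  define K where "K = \<lparr>verts = (\<Union>l\<in>\<L>. set l), edges = (\<Union>l\<in>\<L>. path_edges l)\<rparr>"
  have sub: "subdivision K \<Gamma> (inv_into \<L> link)" "subgraph K H"
    using subdivision_of_linkage[OF \<L>] by (simp_all add: \<Gamma>_def K_def)
  have xy: "[x, y] \<in> \<L>" using f(3) by (auto simp: \<L>_def)
  have xy_verts: "x \<in> verts \<Gamma>" "y \<in> verts \<Gamma>" using xy by (force simp: \<Gamma>_def link_def)+
  have "connected_graph \<lparr>verts = verts \<Gamma>, edges = edges \<Gamma> - F\<rparr>" if "finite F" for F
  proof -
    have "\<exists>N. \<forall>l\<in>M. l \<in> f N" if "finite M" "M \<subseteq> \<L>" for M
      using that
    proof (induction M rule: finite_induct)
      case (insert l M)
      then obtain N where N: "\<forall>l\<in>M. l \<in> f N" by auto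
      obtain n where "l \<in> f n" using insert.prems by (auto simp: \<L>_def)
      then have "\<forall>l\<in>insert l M. l \<in> f (max n N)"
        using N mono[of n "max n N"] mono[of N "max n N"] by auto
      then show ?case by blast
    qed simp
    moreover obtain M where M: "M \<subseteq> \<L>" "finite M" "F \<inter> link ` \<L> = link ` M"
      using finite_subset_image[of "F \<inter> link ` \<L>" link \<L>] \<open>finite F\<close> by auto
    ultimately obtain N where N: "\<And>l. l \<in> M \<Longrightarrow> l \<in> f N" by meson
    have from_x: "(x, a) \<in> reach (edges \<Gamma> - F) {}" if a: "a \<in> verts \<Gamma>" for a
    proof -
      obtain l n where l: "l \<in> f n" "a \<in> link l" using a by (auto simp: \<Gamma>_def \<L>_def)
      \<comment> \<open>Stage \<open>m\<close> already contains \<open>a\<close> as well as all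
        links in \<open>F\<close>, so the links added next avoid \<open>F\<close>.\<close>
      define m where "m = max n N"
      have "a \<in> \<Union>(link ` f m)" using l mono[of n m] by (auto simp: m_def)
      then have "(x, a) \<in> reach (link ` f (Suc m) - link ` f m) {}" by (rule f(5))
      moreover have "M \<subseteq> f m" using N mono[of N m] by (auto simp: m_def)
      then have "F \<inter> link ` \<L> \<subseteq> link ` f m" unfolding M(3) by (rule image_mono)
      moreover have "f (Suc m) \<subseteq> \<L>" by (auto simp: \<L>_def)
      ultimately show ?thesis by (elim reach_mono) (auto simp: \<Gamma>_def)
    qed
    then show ?thesis
      unfolding connected_graph_def adj_rtrancl_eq_reach
      by (auto intro: reach_trans[OF reach_sym])
  qed
  then have con: "inf_edge_connected \<Gamma>"
    using xy_verts y(3) unfolding inf_edge_connected_def by (intro conjI allI impI) blast+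
  have "finitely_separable \<Gamma>"
    by (rule subdivision.finitely_separable_of_subdivision[OF sub(1)])
      (rule finitely_separable_subgraph[OF separable sub(2)])
  then have "pi_graph \<Gamma>" using subdivision.wf_\<Gamma>[OF sub(1)] con by (intro pi_graphI)
  then have "subdivided_pi K (verts \<Gamma>)"
    using subdivision.subdivision_of[OF sub(1)] by (auto simp: subdivided_pi_def)
  moreover have "{x, y} \<in> edges K" using xy by (force simp: K_def)
  ultimately show ?thesis using sub(2) xy_verts by blast
qed

end

section \<open>Splitting along a path\<close>

text \<open>The lift \<open>L\<close> keeps every edge of \<open>G\<close> inside \<open>X\<close>,
  so that \<open>X\<close> induces the same graph as in \<open>G\<close>, and every edge inside
  \<open>Y\<close> that projects to an edge of \<open>K\<close>, including all parallel ones at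
  \<open>X\<close>.\<close>

lemma contract_lift:
  assumes wf: "wf_graph G" and Y: "X \<subseteq> Y" "Y \<subseteq> verts G"
    and K: "subgraph K (contract (induced G Y) X)" "X \<in> verts K"
  defines "L \<equiv> \<lparr>verts = X \<union> {w \<in> Y. {w} \<in> verts K},
    edges = {e \<in> edges G. e \<subseteq> X \<or> (e \<subseteq> Y \<and> proj X ` e \<in> edges K)}\<rparr>"
  shows "subgraph L G" "contract L X = K"
proof -
  have wf_K: "\<And>e. e \<in> edges K \<Longrightarrow> e \<subseteq> verts K" and KV: "verts K \<subseteq> verts (contract (induced G Y) X)"
    and KE: "edges K \<subseteq> edges (contract (induced G Y) X)"
    using K(1) by (auto simp: subgraph_def wf_graph_def)
  have edge_L: "e \<subseteq> verts L" if "e \<subseteq> Y" "proj X ` e \<in> edges K" for e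
  proof
    fix w assume w: "w \<in> e"
    then have "proj X w \<in> verts K" using wf_K[OF that(2)] by blast
    then show "w \<in> verts L" using w that(1) by (cases "w \<in> X") (auto simp: L_def)
  qed
  have "e \<subseteq> verts L" if "e \<in> edges L" for e
    using that edge_L[of e] by (auto simp: L_def)
  then have "wf_graph L" using wf by (auto simp: wf_graph_def L_def)
  then show "subgraph L G" using Y by (auto simp: subgraph_def L_def)
  have out: "{a, b} \<in> edges L \<longleftrightarrow> {a, b} \<in> edges G \<and> {a, b} \<subseteq> Y \<and> proj X ` {a, b} \<in> edges K"
    if "b \<notin> X" for a b
    using that by (auto simp: L_def)
  have V: "verts (contract L X) = verts K"
  proof (intro equalityI subsetI)
    fix p assume "p \<in> verts (contract L X)"
    then show "p \<in> verts K" using K(2) by (auto simp: contract_def L_def)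
  next
    fix p assume p: "p \<in> verts K"
    then have "p \<in> verts (contract (induced G Y) X)" using KV by blast
    then show "p \<in> verts (contract L X)" using p by (auto simp: contract_def L_def induced_def)
  qed
  have E: "edges (contract L X) = edges K"
  proof (intro equalityI subsetI)
    fix e assume "e \<in> edges (contract L X)"
    then consider a b where "e = {{a}, {b}}" "{a, b} \<in> edges L" "a \<notin> X" "b \<notin> X"
      | w x where "e = {X, {w}}" "w \<notin> X" "x \<in> X" "{x, w} \<in> edges L"
      by (auto simp: contract_def)
    then show "e \<in> edges K"
    proof cases
      case 1
      then show ?thesis using out[of b a] by simp
    next
      case 2
      then show ?thesis using out[of w x] by simp
    qed
  next
    fix e assume e: "e \<in> edges K"
    then have "e \<in> edges (contract (induced G Y) X)" using KE by blast
    then consider a b where "e = {{a}, {b}}" "{a, b} \<in> edges G" "{a, b} \<subseteq> Y" "a \<notin> X" "b \<notin> X"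
      | w x where "e = {X, {w}}" "w \<notin> X" "x \<in> X" "{x, w} \<in> edges G" "{x, w} \<subseteq> Y"
      by (auto simp: contract_def induced_def)
    then show "e \<in> edges (contract L X)"
    proof cases
      case 1
      then have "{a, b} \<in> edges L" using out[of b a] e by simp
      then show ?thesis using edges_contract_outside[of a X b L] 1 by simp
    next
      case 2
      then have "{x, w} \<in> edges L" using out[of w x] e by simp
      then show ?thesis using edges_contract_new[OF \<open>wf_graph L\<close>, of w X] 2 by auto
    qed
  qed
  show "contract L X = K" using V E by simp
qed

text \<open>A finite set of contracted edges has only finitely many preimages because
  \<open>X\<close> is finite. A walk avoiding these projects to a walk avoiding \<open>F'\<close>,
  with edges inside \<open>X\<close> becoming stationary.\<close>

lemma reach_contract:
  assumes wf: "wf_graph H" and X: "finite X"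
    and reach: "\<And>F. finite F \<Longrightarrow> (u, s) \<in> reach (edges H - F) {}"
    and us: "u \<notin> X" "s \<in> X" and F': "finite F'"
  shows "({u}, X) \<in> reach (edges (contract H X) - F') {}"
proof -
  let ?E = "edges (contract H X)"
  \<comment> \<open>The set \<open>F'\<close> is arbitrary; only its members that are edges of the
    contraction are known to have a finite union.\<close>
  let ?F = "{e \<in> edges H. proj X ` e \<in> F' \<inter> ?E}"
  have "finite (\<Union>e)" if "e \<in> ?E" for e
    using that X by (auto simp: contract_def)
  moreover have "e \<subseteq> \<Union>(proj X ` e)" for e by (auto simp: proj_def)
  then have "?F \<subseteq> (\<Union>e\<in>F' \<inter> ?E. Pow (\<Union>e))" by blast
  ultimately have "finite ?F" using F' by (auto intro: finite_subset)
  then have "(u, s) \<in> reach (edges H - ?F) {}" by (rule reach)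
  then have "s \<in> {w. ({u}, proj X w) \<in> reach (?E - F') {}}"
  proof (rule reach_closed)
    fix c d assume cd: "c \<in> {w. ({u}, proj X w) \<in> reach (?E - F') {}}" "{c, d} \<in> edges H - ?F"
    have dc: "{d, c} \<in> edges H" using cd by (simp add: insert_commute)
    have "proj X ` {c, d} \<in> ?E" if outside: "c \<notin> X \<or> d \<notin> X"
    proof -
      consider "c \<notin> X" "d \<notin> X" | "c \<in> X" "d \<notin> X" | "c \<notin> X" "d \<in> X" using outside by blast
      then show ?thesis
      proof cases
        case 1
        then show ?thesis using edges_contract_outside[of c X d H] cd(2) by simp
      next
        case 2
        then show ?thesis using edges_contract_new[OF wf, of d X] cd(2) by auto
      next
        case 3
        then have "{X, {c}} \<in> ?E" using edges_contract_new[OF wf, of c X] dc by auto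
        then show ?thesis using 3 by (simp add: insert_commute)
      qed
    qed
    then have "(proj X c, proj X d) \<in> reach (?E - F') {}"
      using cd(2) by (cases "c \<in> X \<and> d \<in> X") (auto intro: reach_edge)
    then show "d \<in> {w. ({u}, proj X w) \<in> reach (?E - F') {}}" using cd(1) reach_trans by (metis mem_Collect_eq)
  qed (use us in simp)
  then show ?thesis using us by simp
qed

text \<open>The vertex \<open>s\<close> puts the contracted vertex into the class of
  \<open>{u}\<close>, and the possibly different vertex \<open>t\<close> makes the two adjacent. A
  subdivided \<Pi>-graph is then found in the contraction and lifted back.\<close>

lemma one_side:
  assumes G: "wf_graph G" "finitely_separable G"
    and XY: "finite X" "X \<subseteq> Y" "Y \<subseteq> verts G" and u: "u \<in> Y" "u \<notin> X"
    and nb: "t \<in> X" "{t, u} \<in> edges G"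
    and s: "s \<in> X" "\<And>F. finite F \<Longrightarrow> (u, s) \<in> reach ({e \<in> edges G. e \<subseteq> Y} - F) {}"
  obtains L B where "subgraph L G" "X \<subseteq> verts L" "verts L \<subseteq> Y"
    "induced L X = induced G X"
    "subdivided_pi (contract L X) B" "{u} \<in> B" "X \<in> B" "{{u}, X} \<in> edges (contract L X)"
proof -
  let ?H = "induced G Y"
  have wf_H: "wf_graph ?H" using G(1) by (auto simp: wf_graph_def induced_def)
  have "subgraph ?H G" using wf_H XY by (auto simp: subgraph_def induced_def)
  then have sep_H: "finitely_separable ?H" using G(2) finitely_separable_subgraph by blast
  have cls: "edge_class (contract ?H X) {u}"
  proof
    show "wf_graph (contract ?H X)" using wf_H by (rule wf_contract)
    show "finitely_separable (contract ?H X)"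
      using sep_H XY by (intro finitely_separable_contract) (simp_all add: induced_def)
    show "{u} \<in> verts (contract ?H X)" using u by (simp add: contract_def induced_def)
  qed
  have "({u}, X) \<in> reach (edges (contract ?H X) - F) {}" if "finite F" for F
    using wf_H XY(1) _ u(2) s(1) that
    by (rule reach_contract) (use s(2) in \<open>simp add: induced_def\<close>)
  then have X_class: "X \<in> edge_class.U (contract ?H X) {u}"
    unfolding edge_class.U_def[OF cls] by (simp add: contract_def)
  have "{t, u} \<in> edges ?H" using nb u XY by (auto simp: induced_def)
  then have "{X, {u}} \<in> edges (contract ?H X)"
    using edges_contract_new[OF wf_H u(2)] nb(1) by blast
  then have "{{u}, X} \<in> edges (contract ?H X)" by (simp add: insert_commute)
  from edge_class.ex_subdivided_pi[OF cls X_class this singleton_neq(1)[OF u(2)]]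
  obtain K B where K: "subgraph K (contract ?H X)" "subdivided_pi K B" "{u} \<in> B" "X \<in> B"
    "{{u}, X} \<in> edges K" by blast
  have "X \<in> verts K" using K(1,5) by (auto simp: subgraph_def wf_graph_def)
  note L = contract_lift[OF G(1) XY(2,3) K(1) this]
  show thesis
    by (rule that[OF L(1)]) (use K XY L(2) in \<open>auto simp: induced_def\<close>)
qed

text \<open>The path is stopped at its first vertex in \<open>S\<close>; everything before lies in
  the component of \<open>u\<close>. This component is taken in the larger edge set
  \<open>E\<close>, while the path keeps to \<open>E'\<close>.\<close>

lemma first_hit:
  assumes "p \<noteq> []" "hd p = u" "u \<notin> S" "path_edges p \<subseteq> E'" "E' \<subseteq> E" "set p \<inter> S \<noteq> {}"
  obtains s where "s \<in> S" "s \<in> set p"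
    "(u, s) \<in> reach {e \<in> E'. e \<subseteq> insert s {w. (u, w) \<in> reach E S}} {}"
proof -
  have "\<exists>s\<in>set p. s \<in> S" using assms(6) by blast
  then obtain m s r where p: "p = m @ s # r" "s \<in> S" "\<forall>w\<in>set m. w \<notin> S"
    using split_list_first_prop[of p "\<lambda>s. s \<in> S"] by blast
  have "m \<noteq> []" using p assms(2,3) by auto
  then obtain m' c where m: "m = m' @ [c]" by (cases m rule: rev_cases) auto
  have "path_edges m \<subseteq> path_edges p" unfolding p(1) m using path_edges_append[of m' c "s # r"] by auto
  then have "path_edges m \<subseteq> E" using assms(4,5) by blast
  moreover have s_path: "path_edges (m @ [s]) \<subseteq> E'"
    using path_edges_append[of m s r] assms(4) p(1) by simp
  moreover have hd: "hd m = u" using assms(2) p(1) \<open>m \<noteq> []\<close> by simp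
  ultimately have "set m \<subseteq> {w. (u, w) \<in> reach E S}"
    using path_reach[of m E S] p(3) by auto
  then have "path_edges (m @ [s]) \<subseteq> {e \<in> E'. e \<subseteq> insert s {w. (u, w) \<in> reach E S}}"
    using path_edges_subset[of _ "m @ [s]"] s_path by fastforce
  then have "(hd (m @ [s]), s) \<in> reach {e \<in> E'. e \<subseteq> insert s {w. (u, w) \<in> reach E S}} {}"
    by (rule path_reach) simp_all
  then show thesis using that[of s] p hd \<open>m \<noteq> []\<close> by simp
qed

theorem theorem6p1:
  fixes G :: "'a graph" and B :: "'a set" and u v :: 'a
  assumes "subdivided_pi G B" and "u \<in> B" and "v \<in> B" and "u \<noteq> v"
  shows "\<exists>Hu Hv. subgraph Hu G \<and> subgraph Hv G \<and>
     (let X = verts Hu \<inter> verts Hv in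
        X \<noteq> {} \<and>
        induced Hu X = induced Hv X \<and> finite X \<and> connected_graph (induced Hu X) \<and>
        u \<notin> X \<and> v \<notin> X \<and>
        (\<exists>Bu. subdivided_pi (contract Hu X) Bu \<and> {u} \<in> Bu \<and> X \<in> Bu) \<and>
        (\<exists>Bv. subdivided_pi (contract Hv X) Bv \<and> {v} \<in> Bv \<and> X \<in> Bv) \<and>
        {{u}, X} \<in> edges (contract Hu X) \<and> {{v}, X} \<in> edges (contract Hv X))"
proof -
  obtain \<Gamma> P where \<Gamma>: "verts \<Gamma> = B" "pi_graph \<Gamma>" and sub: "subdivision G \<Gamma> P"
    using assms(1) unfolding subdivided_pi_def by (metis subdivision_ofE)
  interpret subdivision G \<Gamma> P by (rule sub)
  have sep: "finitely_separable G"
    using \<Gamma>(2) pi_graph_finitely_separable finitely_separable_subdivision by blast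
  have uv_reach: "(u, v) \<in> reach (edges G - F) {}" if "finite F" for F
    using reach_branch_vertices[OF _ that] \<Gamma> assms(2,3) by (simp add: pi_graph_def)
  have uv_verts: "u \<in> verts G" "v \<in> verts G" using verts_eq \<Gamma>(1) assms(2,3) by auto
  obtain F S where FS: "finite F" "finite S" "u \<notin> S" "v \<notin> S" "(u, v) \<notin> reach (edges G - F) S"
    using finitely_separableE[OF sep uv_verts assms(4)] .
  define C where "C a = {w. (a, w) \<in> reach (edges G - F) S}" for a
  define E where "E a s = {e \<in> edges G. e \<subseteq> insert s (C a)}" for a s
  \<comment> \<open>A finite set that separates \<open>a\<close> from \<open>s\<close> in
    \<open>E a s\<close> is taken if there is one, and the empty set otherwise. Thus surviving this
    one deletion means surviving every finite deletion.\<close>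
  have "\<exists>F'. finite F' \<and> ((a, s) \<in> reach (E a s - F') {} \<longrightarrow>
      (\<forall>F. finite F \<longrightarrow> (a, s) \<in> reach (E a s - F) {}))" for a s
    by (metis finite.emptyI)
  then obtain cut where cut: "\<And>a s. finite (cut a s)"
    "\<And>a s F. (a, s) \<in> reach (E a s - cut a s) {} \<Longrightarrow> finite F \<Longrightarrow> (a, s) \<in> reach (E a s - F) {}"
    by metis
  \<comment> \<open>Since \<open>F\<close> is deleted, the path found next must meet
    \<open>S\<close>. As the test sets for all \<open>s \<in> S\<close> are deleted too, whichever
    vertex of \<open>S\<close> it meets first passes the test.\<close>
  let ?F = "F \<union> (\<Union>s\<in>S. cut u s \<union> cut v s)"
  have "finite ?F" using FS cut(1) by simp
  then have "(u, v) \<in> reach (edges G - ?F) {}" by (rule uv_reach)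
  then obtain p where p: "p \<noteq> []" "hd p = u" "last p = v" "distinct p" "path_edges p \<subseteq> edges G - ?F"
    by (rule reach_path) auto
  obtain m where m: "p = u # m @ [v]" using list_ends_cases[OF p(1-3) assms(4)] .
  define X where "X = set m"
  have X: "finite X" "u \<notin> X" "v \<notin> X" using p(4) m by (auto simp: X_def)
  have hit: "set p \<inter> S \<noteq> {}"
  proof
    assume "set p \<inter> S = {}"
    moreover have "path_edges p \<subseteq> edges G - F" using p(5) by blast
    ultimately have "(u, v) \<in> reach (edges G - F) S" using path_reach[of p _ S v] p m by auto
    then show False using FS by simp
  qed
  \<comment> \<open>Used with \<open>p\<close> for \<open>u\<close> and with \<open>rev p\<close>
    for \<open>v\<close>. The vertex found is inner on \<open>p\<close> because \<open>S\<close>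
    contains neither end.\<close>
  have ends: "\<exists>s\<in>X. \<forall>F. finite F \<longrightarrow> (a, s) \<in> reach (E a s - F) {}"
    if q: "q \<noteq> []" "hd q = a" "a \<notin> S" "path_edges q = path_edges p" "set q = set p" "a \<in> {u, v}"
    for a q
  proof -
    have *: "path_edges q \<subseteq> edges G - ?F" "edges G - ?F \<subseteq> edges G - F" "set q \<inter> S \<noteq> {}"
      using q p(5) hit by auto
    obtain s where s: "s \<in> S" "s \<in> set q"
      "(a, s) \<in> reach {e \<in> edges G - ?F. e \<subseteq> insert s (C a)} {}"
      using first_hit[OF q(1-3) *] unfolding C_def by blast
    have "(a, s) \<in> reach (E a s - cut a s) {}"
      by (rule reach_mono[OF s(3)]) (use s(1) q(6) in \<open>auto simp: E_def\<close>)
    then have "\<forall>F. finite F \<longrightarrow> (a, s) \<in> reach (E a s - F) {}" using cut(2) by blast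
    moreover have "s \<in> X" using s(1,2) q(5) FS m by (auto simp: X_def)
    ultimately show ?thesis by blast
  qed
  obtain s where s: "s \<in> X" "\<And>F. finite F \<Longrightarrow> (u, s) \<in> reach (E u s - F) {}"
    using ends[of p u] p FS by auto
  obtain s' where s': "s' \<in> X" "\<And>F. finite F \<Longrightarrow> (v, s') \<in> reach (E v s' - F) {}"
    using ends[of "rev p" v] p FS by (auto simp: path_edges_rev hd_rev)
  have "m \<noteq> []" using s(1) by (auto simp: X_def)
  then obtain m1 c where m1: "m = m1 @ [c]" by (cases m rule: rev_cases) auto
  obtain b m2 where m2: "m = b # m2" using \<open>m \<noteq> []\<close> by (cases m) auto
  have "path_edges p = insert {u, b} (path_edges (m @ [v]))" using m m2 by simp
  moreover have "path_edges (m @ [v]) = path_edges m \<union> {{c, v}}"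
    using path_edges_append[of m1 c "[v]"] m1 by auto
  ultimately have pe: "{b, u} \<in> edges G" "{c, v} \<in> edges G" "path_edges m \<subseteq> edges G"
    using p(5) by (auto simp: insert_commute)
  have bc: "b \<in> X" "c \<in> X" unfolding X_def by (simp add: m2) (simp add: m1)
  have m_reach: "(b, w) \<in> reach {e \<in> edges G. e \<subseteq> X} {}" if "w \<in> X" for w
  proof -
    have "path_edges m \<subseteq> {e \<in> edges G. e \<subseteq> X}" using pe(3) path_edges_subset by (auto simp: X_def)
    then show ?thesis using path_reach[of m _ "{}" w] that m2 by (simp add: X_def)
  qed
  have connected: "connected_graph (induced G X)"
    unfolding connected_graph_def adj_rtrancl_eq_reach
    using m_reach reach_trans[OF reach_sym] by (fastforce simp: induced_def)
  have closed: "(a, w) \<in> reach E' S' \<Longrightarrow> E' \<subseteq> edges G \<Longrightarrow> a \<in> verts G \<Longrightarrow> w \<in> verts G" for a w E' S'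
    by (rule reach_closed) (use wf_G in \<open>auto simp: wf_graph_def subset_iff\<close>)
  have "X \<subseteq> verts G"
    using m_reach closed[of b _ "{e \<in> edges G. e \<subseteq> X}" "{}"] pe(1) wf_G
    by (auto simp: wf_graph_def)
  moreover have "C a \<subseteq> verts G" if "a \<in> verts G" for a
    using closed[of a _ "edges G - F" S] that by (auto simp: C_def)
  ultimately have Y: "C a \<union> X \<subseteq> verts G" if "a \<in> verts G" for a using that by blast
  have in_C: "a \<in> C a \<union> X" for a by (simp add: C_def)
  have widen: "(a, s) \<in> reach ({e \<in> edges G. e \<subseteq> C a \<union> X} - F) {}"
    if "(a, s) \<in> reach (E a s - F) {}" "s \<in> X" for a s F
    by (rule reach_mono[OF that(1)]) (use that(2) in \<open>auto simp: E_def\<close>)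
  obtain Hu Bu where Hu: "subgraph Hu G" "X \<subseteq> verts Hu" "verts Hu \<subseteq> C u \<union> X"
    "induced Hu X = induced G X"
    "subdivided_pi (contract Hu X) Bu" "{u} \<in> Bu" "X \<in> Bu" "{{u}, X} \<in> edges (contract Hu X)"
    using one_side[OF wf_G sep X(1) Un_upper2 Y[OF uv_verts(1)] in_C X(2) bc(1) pe(1) s(1)
        widen[OF s(2) s(1)]] by blast
  obtain Hv Bv where Hv: "subgraph Hv G" "X \<subseteq> verts Hv" "verts Hv \<subseteq> C v \<union> X"
    "induced Hv X = induced G X"
    "subdivided_pi (contract Hv X) Bv" "{v} \<in> Bv" "X \<in> Bv" "{{v}, X} \<in> edges (contract Hv X)"
    using one_side[OF wf_G sep X(1) Un_upper2 Y[OF uv_verts(2)] in_C X(3) bc(2) pe(2) s'(1)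
        widen[OF s'(2) s'(1)]] by blast
  \<comment> \<open>A common vertex would join \<open>u\<close> to \<open>v\<close> despite the
    separator. Hence the two sides meet exactly in \<open>X\<close>, even though \<open>X\<close>
    itself may run through both components.\<close>
  have "C u \<inter> C v = {}"
    using FS(5) reach_trans[OF _ reach_sym] by (fastforce simp: C_def)
  then have eq: "verts Hu \<inter> verts Hv = X" using Hu(2,3) Hv(2,3) by blast
  have "X \<noteq> {}" using bc by blast
  moreover have "induced Hu X = induced Hv X" "connected_graph (induced Hu X)"
    using Hu(4) Hv(4) connected by simp_all
  moreover have "\<exists>Bu. subdivided_pi (contract Hu X) Bu \<and> {u} \<in> Bu \<and> X \<in> Bu"
    "\<exists>Bv. subdivided_pi (contract Hv X) Bv \<and> {v} \<in> Bv \<and> X \<in> Bv"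
    using Hu(5-7) Hv(5-7) by blast+
  ultimately show ?thesis
    using Hu(1,8) Hv(1,8) X
    by (intro exI[of _ Hu] exI[of _ Hv]) (simp only: Let_def eq not_False_eq_True simp_thms)
qed

end
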